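(* Let $G$ be a finitely generated discrete group. Then $G$ is an $\ell^2(G)$-Pompeiu group if and only if $G$ does not contain a nontrivial finite normal subgroup.
   Context: Complex-valued functions on $G$ are written as formal sums $f=\sum_{g\in G}a_g g$ with $f(g)=a_g$; $\ell^2(G)$ is the set of those with $\sum_g|a_g|^2<\infty$. For a class $\mathcal{C}$ of complex-valued functions on $G$ containing $0$, a finite subset $K\subseteq G$ is a $\mathcal{C}$-Pompeiu set if $f=0$ is the only $f\in\mathcal{C}$ satisfying $\sum_{x\in gKh}f(x)=0$ for all $g,h\in G$. $G$ is a $\mathcal{C}$-Pompeiu group if every nonempty finite subset of $G$ is a $\mathcal{C}$-Pompeiu set. *)

theory Defs
  imports "HOL-Analysis.Analysis" "HOL-Algebra.Generated_Groups"
begin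

definition l2_fun :: "('a, 'b) monoid_scheme \<Rightarrow> ('a \<Rightarrow> complex) set" where
  "l2_fun G = {f. f \<in> extensional (carrier G) \<and>
                  (\<lambda>x. (norm (f x))\<^sup>2) summable_on carrier G}"

definition double_translate :: "('a, 'b) monoid_scheme \<Rightarrow> 'a \<Rightarrow> 'a set \<Rightarrow> 'a \<Rightarrow> 'a set" where
  "double_translate G g K h = {g \<otimes>\<^bsub>G\<^esub> k \<otimes>\<^bsub>G\<^esub> h | k. k \<in> K}"

definition pompeiu_set :: "('a, 'b) monoid_scheme \<Rightarrow> ('a \<Rightarrow> complex) set \<Rightarrow> 'a set \<Rightarrow> bool" where
  "pompeiu_set G C K \<longleftrightarrow>
     finite K \<and> K \<subseteq> carrier G \<and>
     (\<forall>f\<in>C. (\<forall>g\<in>carrier G. \<forall>h\<in>carrier G.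
                 (\<Sum>x\<in>double_translate G g K h. f x) = 0) \<longrightarrow> (\<forall>x\<in>carrier G. f x = 0))"

definition pompeiu_group :: "('a, 'b) monoid_scheme \<Rightarrow> ('a \<Rightarrow> complex) set \<Rightarrow> bool" where
  "pompeiu_group G C \<longleftrightarrow>
     (\<forall>K. finite K \<and> K \<subseteq> carrier G \<and> K \<noteq> {} \<longrightarrow> pompeiu_set G C K)"

definition finitely_generated_group :: "('a, 'b) monoid_scheme \<Rightarrow> bool" where
  "finitely_generated_group G \<longleftrightarrow>
     (\<exists>S. finite S \<and> S \<subseteq> carrier G \<and> generate G S = carrier G)"

end

theory Submission
  imports Defs "HOL-Real_Asymp.Real_Asymp"
begin

text \<open>
  If \<open>N\<close> is a nontrivial finite normal subgroup and \<open>n \<in> N\<close> is not \<open>1\<close>, then \<open>\<delta>\<^sub>1 - \<delta>\<^sub>n\<close> sums to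
  zero over every \<open>g N h\<close>, which is a coset of \<open>N\<close>.

  Conversely, the real square summable functions whose sums over all \<open>g K h\<close> vanish form a subspace that
  is closed and invariant under left and right translations. The projection \<open>p\<close> of \<open>\<delta>\<^sub>1\<close> to it is
  invariant under conjugation, so it is supported on the elements with finitely many conjugates. When there
  is no nontrivial finite normal subgroup, these elements form a torsion-free abelian group \<open>\<Delta>\<close>
  (Dietzmann, Schur), and after translating \<open>K\<close> so that it meets \<open>\<Delta>\<close>, the restriction of \<open>p\<close> to \<open>\<Delta>\<close>
  is annihilated by the finite set \<open>K \<inter> \<Delta>\<close>.

  A torsion-free abelian group has no square summable zero divisors. Indeed, the projection \<open>P\<close> onto a nonzero
  translation invariant kernel has constant positive diagonal, so its compression to a finite set \<open>F\<close> has
  rank at least \<open>c |F|\<close>. If the boundary of \<open>F\<close> has fewer elements than this, some function in the kernel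
  vanishes on the boundary of \<open>F\<close> but not on \<open>F\<close>; cutting it off outside \<open>F\<close> gives a finitely supported
  element of the kernel, which is impossible since the group can be ordered. Such sets \<open>F\<close> exist because
  finitely generated abelian groups have polynomial growth.
\<close>

section \<open>Reproducing kernels in real square summable functions\<close>

definition real_l2 :: "'a set \<Rightarrow> ('a \<Rightarrow> real) set" where
  "real_l2 X = {f. (\<lambda>x. (f x)\<^sup>2) summable_on X}"

definition ip :: "'a set \<Rightarrow> ('a \<Rightarrow> real) \<Rightarrow> ('a \<Rightarrow> real) \<Rightarrow> real" where
  "ip X f g = (\<Sum>\<^sub>\<infinity>x\<in>X. f x * g x)"

lemma real_l2_mult_summable:
  assumes "f \<in> real_l2 X" "g \<in> real_l2 X"
  shows "(\<lambda>x. f x * g x) summable_on X"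
proof -
  have "(\<lambda>x. (f x)\<^sup>2 + (g x)\<^sup>2) summable_on X"
    using assms by (auto simp: real_l2_def intro: summable_on_add)
  moreover have "norm (f x * g x) \<le> (f x)\<^sup>2 + (g x)\<^sup>2" for x
  proof -
    have "2 * (\<bar>f x\<bar> * \<bar>g x\<bar>) \<le> (f x)\<^sup>2 + (g x)\<^sup>2"
      using sum_squares_bound[of "\<bar>f x\<bar>" "\<bar>g x\<bar>"] by (simp add: mult.assoc)
    moreover have "0 \<le> \<bar>f x\<bar> * \<bar>g x\<bar>" by simp
    ultimately show ?thesis unfolding real_norm_def abs_mult by linarith
  qed
  ultimately have "(\<lambda>x. norm (f x * g x)) summable_on X"
    by (rule summable_on_comparison_test) auto
  thus ?thesis
    by (rule abs_summable_summable)
qed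

lemma real_l2_add:
  assumes "f \<in> real_l2 X" "g \<in> real_l2 X"
  shows "(\<lambda>x. f x + g x) \<in> real_l2 X"
proof -
  have "(\<lambda>x. (f x)\<^sup>2 + 2 * (f x * g x) + (g x)\<^sup>2) summable_on X"
    using assms by (intro summable_on_add summable_on_cmult_right real_l2_mult_summable) (auto simp: real_l2_def)
  thus ?thesis
    by (simp add: real_l2_def power2_sum algebra_simps)
qed

lemma real_l2_scale:
  assumes "f \<in> real_l2 X"
  shows "(\<lambda>x. c * f x) \<in> real_l2 X"
  using assms by (auto simp: real_l2_def power_mult_distrib intro: summable_on_cmult_right)

lemma ip_commute: "ip X f g = ip X g f"
  by (simp add: ip_def mult.commute)

lemma ip_add_left:
  assumes "f \<in> real_l2 X" "g \<in> real_l2 X" "h \<in> real_l2 X"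
  shows "ip X (\<lambda>x. f x + g x) h = ip X f h + ip X g h"
  unfolding ip_def using assms
  by (simp add: distrib_right infsum_add real_l2_mult_summable)

lemma ip_scale_left: "ip X (\<lambda>x. c * f x) h = c * ip X f h"
  unfolding ip_def by (simp add: mult.assoc infsum_cmult_right')

lemma ip_scale_self: "ip X (\<lambda>x. c * f x) (\<lambda>x. c * f x) = c\<^sup>2 * ip X f f"
proof -
  have "(\<lambda>x. c * f x * (c * f x)) = (\<lambda>x. c\<^sup>2 * (f x * f x))"
    by (simp add: power2_eq_square mult_ac)
  thus ?thesis unfolding ip_def by (simp add: infsum_cmult_right')
qed

lemma ip_add_scale_self:
  assumes f: "f \<in> real_l2 X" and g: "g \<in> real_l2 X"
  shows "ip X (\<lambda>x. f x + c * g x) (\<lambda>x. f x + c * g x) = ip X f f + 2 * c * ip X f g + c\<^sup>2 * ip X g g"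
proof -
  have cg: "(\<lambda>x. c * g x) \<in> real_l2 X"
    using g by (rule real_l2_scale)
  have fcg: "(\<lambda>x. f x + c * g x) \<in> real_l2 X"
    using f cg by (rule real_l2_add)
  have expand: "ip X (\<lambda>x. f x + c * g x) h = ip X f h + c * ip X g h" if "h \<in> real_l2 X" for h
    using that f cg by (simp add: ip_add_left ip_scale_left)
  have "ip X f (\<lambda>x. f x + c * g x) = ip X f f + c * ip X f g"
    using expand[OF f] ip_commute[of X f g] ip_commute[of X f "\<lambda>x. f x + c * g x"] by simp
  moreover have "ip X g (\<lambda>x. f x + c * g x) = ip X f g + c * ip X g g"
    using expand[OF g] ip_commute[of X g "\<lambda>x. f x + c * g x"] by simp
  ultimately show ?thesis
    unfolding expand[OF fcg] by (simp add: power2_eq_square algebra_simps)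
qed

lemma sum_squares_le_ip:
  assumes "f \<in> real_l2 X" "finite A" "A \<subseteq> X"
  shows "(\<Sum>x\<in>A. (f x)\<^sup>2) \<le> ip X f f"
proof -
  have "(\<Sum>x\<in>A. (f x)\<^sup>2) \<le> (\<Sum>\<^sub>\<infinity>x\<in>X. (f x)\<^sup>2)"
    using assms by (intro finite_sum_le_infsum) (auto simp: real_l2_def)
  thus ?thesis by (simp add: ip_def power2_eq_square)
qed

lemma square_le_ip:
  assumes "f \<in> real_l2 X" "a \<in> X"
  shows "(f a)\<^sup>2 \<le> ip X f f"
  using sum_squares_le_ip[OF assms(1), of "{a}"] assms(2) by simp

lemma ip_self_nonneg: "0 \<le> ip X f f"
  unfolding ip_def by (intro infsum_nonneg) simp

text \<open>Only finite partial sums enter the hypothesis, and these pass to pointwise limits; so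
  this is what controls the norm of a pointwise limit in
  \<open>ex_reproducing_kernel\<close>.\<close>

lemma real_l2_bounded_sums:
  assumes "\<And>A. finite A \<Longrightarrow> A \<subseteq> X \<Longrightarrow> (\<Sum>x\<in>A. (f x)\<^sup>2) \<le> C"
  shows "f \<in> real_l2 X" "ip X f f \<le> C"
proof -
  have "(\<lambda>x. (f x)\<^sup>2) summable_on X"
    using assms by (intro nonneg_bdd_above_summable_on bdd_aboveI[where M=C]) auto
  thus "f \<in> real_l2 X" by (simp add: real_l2_def)
  have "(\<Sum>\<^sub>\<infinity>x\<in>X. (f x)\<^sup>2) \<le> C"
    using assms \<open>(\<lambda>x. (f x)\<^sup>2) summable_on X\<close> by (intro infsum_le_finite_sums) auto
  thus "ip X f f \<le> C"
    by (simp add: ip_def power2_eq_square)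
qed

section \<open>Closed subspaces and their reproducing kernels\<close>

lemma nonneg_quadratic_linear_coeff_zero:
  fixes A B :: real
  assumes "\<And>t. 0 \<le> t\<^sup>2 * A + 2 * t * B" "0 \<le> A"
  shows "B = 0"
proof (rule ccontr)
  assume "B \<noteq> 0"
  \<comment> \<open>The vertex of the parabola is at \<open>- B / A\<close>; the denominator
    \<open>A + 1\<close> also gives a negative value and covers \<open>A = 0\<close>.\<close>
  have "(- B / (A + 1))\<^sup>2 * A + 2 * (- B / (A + 1)) * B = - (B\<^sup>2 * (A + 2)) / (A + 1)\<^sup>2"
    using assms(2) by (simp add: divide_simps power2_eq_square) (simp add: algebra_simps)
  also have "\<dots> < 0"
    using assms(2) \<open>B \<noteq> 0\<close> by (intro divide_neg_pos) (auto intro!: mult_pos_pos)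
  finally show False using assms(1)[of "- B / (A + 1)"] by simp
qed

text \<open>Closedness under pointwise limits is a stronger form of being closed; it holds for subspaces
  cut out by conditions involving finitely many values each.\<close>

locale l2_subspace =
  fixes X :: "'a set" and V :: "('a \<Rightarrow> real) set"
  assumes sub_l2: "V \<subseteq> real_l2 X"
    and zero_in: "(\<lambda>x. 0) \<in> V"
    and add_in: "\<And>f g. f \<in> V \<Longrightarrow> g \<in> V \<Longrightarrow> (\<lambda>x. f x + g x) \<in> V"
    and scale_in: "\<And>f c. f \<in> V \<Longrightarrow> (\<lambda>x. c * f x) \<in> V"
    and limit_in: "\<And>F f. (\<And>n. F n \<in> V) \<Longrightarrow> (\<And>x. x \<in> X \<Longrightarrow> (\<lambda>n. F n x) \<longlonglongrightarrow> f x)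
                    \<Longrightarrow> f \<in> real_l2 X \<Longrightarrow> f \<in> V"
begin

lemma in_l2: "f \<in> V \<Longrightarrow> f \<in> real_l2 X"
  using sub_l2 by blast

lemma sum_in:
  assumes "finite A" "\<And>a. a \<in> A \<Longrightarrow> f a \<in> V"
  shows "(\<lambda>x. \<Sum>a\<in>A. c a * f a x) \<in> V"
  using assms
proof (induction A rule: finite_induct)
  case empty
  thus ?case by (simp add: zero_in)
next
  case (insert b A)
  have "(\<lambda>x. c b * f b x + (\<Sum>a\<in>A. c a * f a x)) \<in> V"
    using insert by (intro add_in scale_in) simp_all
  thus ?case using insert.hyps by simp
qed

lemma ip_sum_left:
  assumes "finite A" "\<And>a. a \<in> A \<Longrightarrow> f a \<in> V" "g \<in> V"
  shows "ip X (\<lambda>x. \<Sum>a\<in>A. c a * f a x) g = (\<Sum>a\<in>A. c a * ip X (f a) g)"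
  using assms(1,2)
proof (induction A rule: finite_induct)
  case empty
  thus ?case by (simp add: ip_def)
next
  case (insert a A)
  have "ip X (\<lambda>x. c a * f a x + (\<Sum>a\<in>A. c a * f a x)) g = ip X (\<lambda>x. c a * f a x) g + ip X (\<lambda>x. \<Sum>a\<in>A. c a * f a x) g"
    using insert assms(3) by (intro ip_add_left in_l2 scale_in sum_in) auto
  thus ?case using insert by (simp add: ip_scale_left)
qed

text \<open>The kernel is the orthogonal projection of the point mass at \<open>a\<close>: the functional \<open>J\<close> below is
  \<open>\<parallel>v - \<delta>\<^sub>a\<parallel>\<^sup>2 - 1\<close>, and a minimising sequence is pointwise Cauchy by the parallelogram law.\<close>

lemma ex_reproducing_kernel:
  assumes a: "a \<in> X"
  shows "\<exists>p\<in>V. \<forall>v\<in>V. ip X p v = v a"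
proof -
  define J where "J v = ip X v v - 2 * v a" for v
  have J_ge: "-1 \<le> J v" if "v \<in> V" for v
  proof -
    have "0 \<le> (v a - 1)\<^sup>2" by simp
    hence "-1 \<le> (v a)\<^sup>2 - 2 * v a" by (simp add: power2_diff)
    thus ?thesis using square_le_ip[OF in_l2[OF that] a] by (simp add: J_def)
  qed
  hence bdd: "bdd_below (J ` V)" by (intro bdd_belowI2)
  define d where "d = Inf (J ` V)"
  have d_le: "d \<le> J v" if "v \<in> V" for v
    unfolding d_def using bdd that by (auto intro: cInf_lower)
  have "\<exists>v\<in>V. J v < d + 1 / (real n + 1)" for n
    using cInf_lessD[of "J ` V" "d + 1 / (real n + 1)"] zero_in unfolding d_def by auto
  then obtain w where w: "\<And>n. w n \<in> V" "\<And>n. J (w n) < d + 1 / (real n + 1)"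
    by metis
  have dist: "(w m x - w n x)\<^sup>2 \<le> 2 / (real m + 1) + 2 / (real n + 1)" if x: "x \<in> X" for m n x
  proof -
    let ?f = "w m" and ?g = "w n"
    have l2: "?f \<in> real_l2 X" "?g \<in> real_l2 X" using w in_l2 by auto
    have mid: "(\<lambda>x. (1/2) * (?f x + ?g x)) \<in> V"
      using w by (intro scale_in add_in) auto
    have diff: "(\<lambda>x. ?f x + (-1) * ?g x) \<in> V"
      using w(1) by (intro scale_in add_in) auto
    have 1: "ip X (\<lambda>x. (1/2) * (?f x + ?g x)) (\<lambda>x. (1/2) * (?f x + ?g x))
        = (ip X ?f ?f + 2 * ip X ?f ?g + ip X ?g ?g) / 4"
      unfolding ip_scale_self using ip_add_scale_self[OF l2, of 1] by (simp add: power2_eq_square)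
    \<comment> \<open>The part \<open>- 2 * v a\<close> of \<open>J\<close> is linear in
      \<open>v\<close>, so it cancels and the parallelogram law for norms becomes an identity for
      \<open>J\<close>. The midpoint lies in \<open>V\<close>, where \<open>J\<close> is at least
      \<open>d\<close>.\<close>
    have "ip X (\<lambda>x. ?f x + (-1) * ?g x) (\<lambda>x. ?f x + (-1) * ?g x)
        = 2 * J ?f + 2 * J ?g - 4 * J (\<lambda>x. (1/2) * (?f x + ?g x))"
      unfolding ip_add_scale_self[OF l2] J_def 1 by (simp add: field_simps)
    also have "\<dots> \<le> 2 / (real m + 1) + 2 / (real n + 1)"
      using w(2)[of m] w(2)[of n] d_le[OF mid] by simp
    finally show ?thesis
      using square_le_ip[OF in_l2[OF diff] x] by simp
  qed
  define p where "p x = lim (\<lambda>n. w n x)" for x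
  have lim: "(\<lambda>n. w n x) \<longlonglongrightarrow> p x" if x: "x \<in> X" for x
  proof -
    have "Cauchy (\<lambda>n. w n x)"
    proof (rule metric_CauchyI)
      fix e :: real assume e: "e > 0"
      obtain M :: nat where M: "4 / e\<^sup>2 < real M" using reals_Archimedean2 by blast
      have small: "2 / (real n + 1) < e\<^sup>2 / 2" if "n \<ge> M" for n
      proof -
        have "4 / e\<^sup>2 < real n + 1" using M that by linarith
        thus ?thesis using e by (simp add: field_simps)
      qed
      have "dist (w m x) (w n x) < e" if "m \<ge> M" "n \<ge> M" for m n
      proof -
        have "(w m x - w n x)\<^sup>2 < e\<^sup>2"
          using dist[OF x, of m n] small[OF that(1)] small[OF that(2)] by linarith
        hence "\<bar>w m x - w n x\<bar> < \<bar>e\<bar>" by (metis abs_le_square_iff not_le)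
        thus ?thesis using e by (simp add: dist_real_def)
      qed
      thus "\<exists>M. \<forall>m\<ge>M. \<forall>n\<ge>M. dist (w m x) (w n x) < e" by blast
    qed
    thus ?thesis unfolding p_def by (simp add: Cauchy_convergent_iff convergent_LIMSEQ_iff)
  qed
  \<comment> \<open>Pointwise convergence suffices for \<open>J p \<le> d\<close>: a finite partial
    sum for \<open>w n\<close> is at most \<open>J (w n) + 2 * w n a\<close>, and both sides
    converge.\<close>
  have fatou: "(\<Sum>x\<in>A. (p x)\<^sup>2) \<le> d + 2 * p a" if A: "finite A" "A \<subseteq> X" for A
  proof (rule LIMSEQ_le)
    show "(\<lambda>n. \<Sum>x\<in>A. (w n x)\<^sup>2) \<longlonglongrightarrow> (\<Sum>x\<in>A. (p x)\<^sup>2)"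
      using A by (intro tendsto_sum tendsto_power lim) auto
    have "(\<lambda>n. d + 1 / (real n + 1) + 2 * w n a) \<longlonglongrightarrow> d + 0 + 2 * p a"
      using LIMSEQ_inverse_real_of_nat by (intro tendsto_intros lim a) (simp add: inverse_eq_divide add.commute)
    thus "(\<lambda>n. d + 1 / (real n + 1) + 2 * w n a) \<longlonglongrightarrow> d + 2 * p a" by simp
    have "(\<Sum>x\<in>A. (w n x)\<^sup>2) \<le> d + 1 / (real n + 1) + 2 * w n a" for n
      using sum_squares_le_ip[OF in_l2[OF w(1)] A, of n] w(2)[of n] by (simp add: J_def)
    thus "\<exists>N. \<forall>n\<ge>N. (\<Sum>x\<in>A. (w n x)\<^sup>2) \<le> d + 1 / (real n + 1) + 2 * w n a" by blast
  qed
  have p_l2: "p \<in> real_l2 X" and J_p: "J p \<le> d"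
    using real_l2_bounded_sums[of X p, OF fatou] by (auto simp: J_def)
  have p: "p \<in> V"
    using limit_in[OF w(1) lim p_l2] .
  have "ip X p v = v a" if v: "v \<in> V" for v
  proof -
    \<comment> \<open>First variation: the minimiser \<open>p\<close> is perturbed in the direction
      \<open>v\<close>.\<close>
    have "0 \<le> t\<^sup>2 * ip X v v + 2 * t * (ip X p v - v a)" for t
    proof -
      have "J p \<le> J (\<lambda>x. p x + t * v x)"
        using J_p d_le[OF add_in[OF p scale_in[OF v, of t]]] by simp
      thus ?thesis
        unfolding J_def ip_add_scale_self[OF p_l2 in_l2[OF v]] by (simp add: algebra_simps)
    qed
    from nonneg_quadratic_linear_coeff_zero[OF this ip_self_nonneg] show ?thesis by simp
  qed
  thus ?thesis using p by blast
qed

text \<open>The reproducing property determines the function only on \<open>X\<close> (see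
  \<open>kernel_unique\<close>), so one is chosen.\<close>

definition kernel :: "'a \<Rightarrow> 'a \<Rightarrow> real" where
  "kernel a = (SOME p. p \<in> V \<and> (\<forall>v\<in>V. ip X p v = v a))"

lemma
  assumes "a \<in> X"
  shows kernel_in: "kernel a \<in> V" and ip_kernel: "v \<in> V \<Longrightarrow> ip X (kernel a) v = v a"
proof -
  have "\<exists>p. p \<in> V \<and> (\<forall>v\<in>V. ip X p v = v a)"
    using ex_reproducing_kernel[OF assms] by (simp add: Bex_def)
  from someI_ex[OF this] show "kernel a \<in> V" "v \<in> V \<Longrightarrow> ip X (kernel a) v = v a"
    by (simp_all add: kernel_def)
qed

lemma kernel_commute:
  assumes "a \<in> X" "b \<in> X"
  shows "kernel a b = kernel b a"
proof -
  have "kernel a b = ip X (kernel b) (kernel a)"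
    using ip_kernel[OF assms(2) kernel_in[OF assms(1)]] by (rule sym)
  also have "\<dots> = ip X (kernel a) (kernel b)" by (rule ip_commute)
  also have "\<dots> = kernel b a" using ip_kernel[OF assms(1) kernel_in[OF assms(2)]] .
  finally show ?thesis .
qed

lemma kernel_unique:
  assumes "a \<in> X" "q \<in> V" "\<And>v. v \<in> V \<Longrightarrow> ip X q v = v a" "x \<in> X"
  shows "q x = kernel a x"
proof -
  have "q x = ip X (kernel x) q" using ip_kernel[OF assms(4,2)] by (rule sym)
  also have "\<dots> = ip X q (kernel x)" by (rule ip_commute)
  also have "\<dots> = kernel x a" using kernel_in[OF assms(4)] by (rule assms(3))
  also have "\<dots> = kernel a x" using assms(4,1) by (rule kernel_commute)
  finally show ?thesis .
qed

lemma kernel_diag_nonneg: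
  assumes "a \<in> X"
  shows "0 \<le> kernel a a"
  using ip_kernel[OF assms kernel_in[OF assms]] ip_self_nonneg[of X "kernel a"] by simp

text \<open>\<open>kernel a a\<close> is the squared norm of \<open>kernel a\<close>, which
  represents evaluation at \<open>a\<close> on \<open>V\<close>. Both vanishing theorems below are
  obtained by showing that this diagonal is zero.\<close>

lemma vanish_if_kernel_diag_zero:
  assumes "a \<in> X" "kernel a a = 0" "v \<in> V"
  shows "v a = 0"
proof -
  have "ip X (kernel a) (kernel a) = 0" using ip_kernel[OF assms(1) kernel_in[OF assms(1)]] assms(2) by simp
  hence "kernel a x = 0" if "x \<in> X" for x
    using square_le_ip[OF in_l2[OF kernel_in[OF assms(1)]] that] by simp
  hence "ip X (kernel a) v = 0" unfolding ip_def by (simp add: infsum_0)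
  thus ?thesis using ip_kernel[OF assms(1,3)] by simp
qed

end

section \<open>The rank bound for the trace of a compressed projection\<close>

text \<open>Gram-Schmidt, one vector \<open>t b\<close> at a time. That \<open>E\<close> spans all
  \<open>t b\<close> on \<open>F\<close> is expressed dually: whatever is orthogonal to
  \<open>E\<close> is orthogonal to every \<open>t b\<close>.\<close>

lemma ex_orthonormal_family:
  fixes t :: "'b \<Rightarrow> 'a \<Rightarrow> real"
  assumes F: "finite F" and "finite B"
  shows "\<exists>E. finite E \<and> card E \<le> card B \<and>
           (\<forall>e\<in>E. \<forall>e'\<in>E. (\<Sum>y\<in>F. e y * e' y) = (if e = e' then 1 else 0)) \<and>
           (\<forall>u. (\<forall>e\<in>E. (\<Sum>y\<in>F. u y * e y) = 0) \<longrightarrow> (\<forall>b\<in>B. (\<Sum>y\<in>F. u y * t b y) = 0))"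
  using assms(2)
proof (induction B rule: finite_induct)
  case empty
  show ?case by (intro exI[of _ "{}"]) auto
next
  case (insert b B)
  then obtain E where E: "finite E" "card E \<le> card B"
    and on: "\<forall>e\<in>E. \<forall>e'\<in>E. (\<Sum>y\<in>F. e y * e' y) = (if e = e' then 1 else 0)"
    and ann: "\<forall>u. (\<forall>e\<in>E. (\<Sum>y\<in>F. u y * e y) = 0) \<longrightarrow> (\<forall>b\<in>B. (\<Sum>y\<in>F. u y * t b y) = 0)"
    by (elim exE conjE)
  define r where "r y = t b y - (\<Sum>e\<in>E. (\<Sum>z\<in>F. t b z * e z) * e y)" for y
  have expand: "(\<Sum>y\<in>F. u y * r y) = (\<Sum>y\<in>F. u y * t b y) - (\<Sum>e\<in>E. (\<Sum>z\<in>F. t b z * e z) * (\<Sum>y\<in>F. u y * e y))" for u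
  proof -
    have "(\<Sum>y\<in>F. u y * r y) = (\<Sum>y\<in>F. u y * t b y) - (\<Sum>y\<in>F. \<Sum>e\<in>E. (\<Sum>z\<in>F. t b z * e z) * (u y * e y))"
      by (simp add: r_def right_diff_distrib sum_subtractf sum_distrib_left mult.left_commute)
    also have "(\<Sum>y\<in>F. \<Sum>e\<in>E. (\<Sum>z\<in>F. t b z * e z) * (u y * e y)) = (\<Sum>e\<in>E. (\<Sum>z\<in>F. t b z * e z) * (\<Sum>y\<in>F. u y * e y))"
      by (subst sum.swap) (simp add: sum_distrib_left)
    finally show ?thesis .
  qed
  have r_orth: "(\<Sum>y\<in>F. e y * r y) = 0" if e: "e \<in> E" for e
  proof -
    have "(\<Sum>e'\<in>E. (\<Sum>z\<in>F. t b z * e' z) * (\<Sum>y\<in>F. e y * e' y)) = (\<Sum>e'\<in>E. if e = e' then (\<Sum>z\<in>F. t b z * e' z) else 0)"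
      using e on by (intro sum.cong) auto
    also have "\<dots> = (\<Sum>z\<in>F. t b z * e z)" using e E by simp
    finally show ?thesis by (simp add: expand mult.commute)
  qed
  have t_ann: "(\<Sum>y\<in>F. u y * t b y) = 0" if "\<And>e. e \<in> E \<Longrightarrow> (\<Sum>y\<in>F. u y * e y) = 0" "(\<Sum>y\<in>F. u y * r y) = 0" for u
    using expand[of u] that by simp
  define c where "c = (\<Sum>y\<in>F. r y * r y)"
  show ?case
  proof (cases "c = 0")
    \<comment> \<open>On \<open>F\<close>, the vector \<open>t b\<close> is already a combination of
      \<open>E\<close>, so nothing is added.\<close>
    case True
    hence "\<forall>y\<in>F. r y = 0"
      using F by (simp add: c_def sum_nonneg_eq_0_iff)
    hence "(\<Sum>y\<in>F. u y * r y) = 0" for u by simp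
    hence "\<forall>b\<in>insert b B. (\<Sum>y\<in>F. u y * t b y) = 0" if "\<forall>e\<in>E. (\<Sum>y\<in>F. u y * e y) = 0" for u
      using that ann t_ann by simp
    thus ?thesis using E on insert.hyps
      by (intro exI[of _ E] conjI) simp_all
  next
    case False
    moreover have "c \<ge> 0" unfolding c_def by (intro sum_nonneg) simp
    ultimately have c: "c > 0" by simp
    define e0 where "e0 y = r y / sqrt c" for y
    have e0: "(\<Sum>y\<in>F. e0 y * e0 y) = 1"
    proof -
      have "(\<Sum>y\<in>F. e0 y * e0 y) = (\<Sum>y\<in>F. r y * r y / c)"
        using c by (intro sum.cong) (auto simp: e0_def)
      thus ?thesis using c by (simp add: c_def flip: sum_divide_distrib)
    qed
    have e0_sum: "(\<Sum>y\<in>F. u y * e0 y) = (\<Sum>y\<in>F. u y * r y) / sqrt c" for u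
      by (simp add: e0_def sum_divide_distrib)
    have e0_orth: "(\<Sum>y\<in>F. e y * e0 y) = 0" "(\<Sum>y\<in>F. e0 y * e y) = 0" if "e \<in> E" for e
      using r_orth[OF that] e0_sum[of e] by (simp_all add: mult.commute)
    have "e0 \<notin> E"
    proof
      assume "e0 \<in> E"
      from e0_orth(1)[OF this] e0 show False by simp
    qed
    have "\<forall>b\<in>insert b B. (\<Sum>y\<in>F. u y * t b y) = 0" if u: "\<forall>e\<in>insert e0 E. (\<Sum>y\<in>F. u y * e y) = 0" for u
    proof -
      have "(\<Sum>y\<in>F. u y * r y) = 0" using u e0_sum[of u] c by simp
      thus ?thesis using u ann t_ann[of u] by simp
    qed
    moreover have "(\<Sum>y\<in>F. e y * e' y) = (if e = e' then 1 else 0)"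
      if "e \<in> insert e0 E" "e' \<in> insert e0 E" for e e'
      using that on e0 e0_orth \<open>e0 \<notin> E\<close> by (cases "e = e0"; cases "e' = e0") simp_all
    ultimately show ?thesis
      using E insert.hyps \<open>e0 \<notin> E\<close>
      by (intro exI[of _ "insert e0 E"] conjI) simp_all
  qed
qed

text \<open>The left-hand side is the trace of the projection onto \<open>V\<close> compressed to \<open>F\<close>; it is bounded by
  the rank of this compression, hence by the number of values needed to determine a member of \<open>V\<close> on \<open>F\<close>.\<close>

lemma (in l2_subspace) sum_kernel_diag_le_card:
  assumes F: "finite F" "F \<subseteq> X" and B: "B \<subseteq> F"
    and determined: "\<And>v. v \<in> V \<Longrightarrow> \<forall>b\<in>B. v b = 0 \<Longrightarrow> \<forall>x\<in>F. v x = 0"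
  shows "(\<Sum>x\<in>F. kernel x x) \<le> real (card B)"
proof -
  have "finite B" using F B finite_subset by auto
  obtain E where E: "finite E" "card E \<le> card B"
    and on: "\<forall>e\<in>E. \<forall>e'\<in>E. (\<Sum>y\<in>F. e y * e' y) = (if e = e' then 1 else 0)"
    and ann: "\<forall>u. (\<forall>e\<in>E. (\<Sum>y\<in>F. u y * e y) = 0) \<longrightarrow> (\<forall>b\<in>B. (\<Sum>y\<in>F. u y * kernel b y) = 0)"
    using ex_orthonormal_family[OF F(1) \<open>finite B\<close>, of kernel] by (elim exE conjE)
  have comm: "kernel y z = kernel z y" if "y \<in> F" "z \<in> F" for y z
    using that F by (intro kernel_commute) auto
  have kF: "\<And>y. y \<in> F \<Longrightarrow> kernel y \<in> V" using F kernel_in by auto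
  have bound: "kernel x x \<le> (\<Sum>e\<in>E. (e x)\<^sup>2)" if x: "x \<in> F" for x
  proof -
    \<comment> \<open>On \<open>F\<close>, \<open>t\<close> is the orthogonal projection of the
      point mass at \<open>x\<close> to the span of \<open>E\<close>, and \<open>w\<close> is its
      image under the kernel matrix.\<close>
    define t where "t y = (\<Sum>e\<in>E. e x * e y)" for y
    define w where "w z = (\<Sum>y\<in>F. t y * kernel y z)" for z
    have t_e: "(\<Sum>y\<in>F. t y * e y) = e x" if e: "e \<in> E" for e
    proof -
      have "(\<Sum>y\<in>F. t y * e y) = (\<Sum>y\<in>F. \<Sum>e'\<in>E. e' x * (e' y * e y))"
        by (simp add: t_def sum_distrib_right mult.assoc)
      also have "\<dots> = (\<Sum>e'\<in>E. e' x * (\<Sum>y\<in>F. e' y * e y))"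
        by (subst sum.swap) (simp add: sum_distrib_left)
      also have "\<dots> = (\<Sum>e'\<in>E. if e' = e then e' x else 0)"
        using e on by (intro sum.cong) auto
      finally show ?thesis using e E by simp
    qed
    \<comment> \<open>The remainder \<open>u\<close> is orthogonal to \<open>E\<close>, hence to the
      rows \<open>kernel b\<close> with \<open>b \<in> B\<close>. The combination of kernels with
      coefficients \<open>u\<close> therefore vanishes on \<open>B\<close>, and by
      \<open>determined\<close> on \<open>F\<close>; so \<open>w\<close> agrees with
      \<open>kernel x\<close> there.\<close>
    define u where "u y = (if y = x then 1 else 0) - t y" for y
    have u_sum: "(\<Sum>y\<in>F. u y * h y) = h x - (\<Sum>y\<in>F. t y * h y)" for h
    proof -
      have "(\<Sum>y\<in>F. u y * h y) = (\<Sum>y\<in>F. (if y = x then h y else 0) - t y * h y)"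
        by (intro sum.cong) (auto simp: u_def algebra_simps)
      thus ?thesis using F x by (simp add: sum_subtractf)
    qed
    have u_E: "(\<Sum>y\<in>F. u y * e y) = 0" if "e \<in> E" for e
      using u_sum t_e[OF that] by simp
    have "(\<lambda>z. \<Sum>y\<in>F. u y * kernel y z) \<in> V"
      using F(1) kF by (rule sum_in)
    moreover have "(\<Sum>y\<in>F. u y * kernel y b) = 0" if "b \<in> B" for b
    proof -
      have "(\<Sum>y\<in>F. u y * kernel y b) = (\<Sum>y\<in>F. u y * kernel b y)"
        using that B comm[of _ b] by (intro sum.cong refl) auto
      thus ?thesis using ann[rule_format, OF u_E that] by simp
    qed
    ultimately have zero: "\<forall>z\<in>F. (\<Sum>y\<in>F. u y * kernel y z) = 0"
      using determined by blast
    have w_eq: "w z = kernel x z" if "z \<in> F" for z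
      using zero that u_sum[of "\<lambda>y. kernel y z"] by (simp add: w_def)
    have w_V: "w \<in> V" unfolding w_def using F(1) kF by (rule sum_in)
    have "ip X (\<lambda>z. \<Sum>y\<in>F. t y * kernel y z) w = (\<Sum>y\<in>F. t y * ip X (kernel y) w)"
      using F(1) kF w_V by (rule ip_sum_left)
    hence "ip X w w = (\<Sum>y\<in>F. t y * ip X (kernel y) w)"
      unfolding w_def[symmetric] .
    also have "\<dots> = (\<Sum>y\<in>F. t y * w y)"
      using F w_V by (intro sum.cong) (auto simp: ip_kernel)
    finally have ip_w: "ip X w w = (\<Sum>y\<in>F. t y * w y)" .
    \<comment> \<open>The projection onto \<open>V\<close> is a contraction: twice the squared norm
      of \<open>w\<close> is at most the squared norm of \<open>t\<close> plus that of
      \<open>w\<close>.\<close>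
    have "(\<Sum>y\<in>F. 2 * (t y * w y)) \<le> (\<Sum>y\<in>F. (t y)\<^sup>2 + (w y)\<^sup>2)"
      using sum_squares_bound by (intro sum_mono) (simp add: mult.assoc)
    also have "\<dots> \<le> (\<Sum>y\<in>F. (t y)\<^sup>2) + ip X w w"
      using sum_squares_le_ip[OF in_l2[OF w_V] F] by (simp add: sum.distrib)
    finally have "ip X w w \<le> (\<Sum>y\<in>F. (t y)\<^sup>2)"
      using ip_w by (simp flip: sum_distrib_left)
    also have "(\<Sum>y\<in>F. (t y)\<^sup>2) = (\<Sum>y\<in>F. \<Sum>e\<in>E. e x * (t y * e y))"
      by (simp add: power2_eq_square) (simp add: t_def sum_distrib_left mult_ac)
    also have "\<dots> = (\<Sum>e\<in>E. e x * (\<Sum>y\<in>F. t y * e y))"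
      by (subst sum.swap) (simp add: sum_distrib_left)
    also have "\<dots> = (\<Sum>e\<in>E. (e x)\<^sup>2)"
      using t_e by (simp add: power2_eq_square)
    finally have "ip X w w \<le> (\<Sum>e\<in>E. (e x)\<^sup>2)" .
    \<comment> \<open>By symmetry of the kernel the sum is \<open>w x\<close>, which equals
      \<open>kernel x x\<close>.\<close>
    moreover have "ip X w w = (\<Sum>y\<in>F. t y * kernel y x)"
      unfolding ip_w using comm[OF x] by (intro sum.cong refl) (simp add: w_eq)
    ultimately show ?thesis using w_eq[OF x] by (simp add: w_def)
  qed
  have "(\<Sum>x\<in>F. kernel x x) \<le> (\<Sum>x\<in>F. \<Sum>e\<in>E. (e x)\<^sup>2)"
    using bound by (rule sum_mono)
  also have "\<dots> = (\<Sum>e\<in>E. \<Sum>x\<in>F. e x * e x)"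
    by (subst sum.swap) (simp add: power2_eq_square)
  also have "\<dots> = real (card E)" using on by simp
  finally show ?thesis using E(2) by linarith
qed

section \<open>Invariance of kernels, and subspaces defined by finite sums\<close>

lemma real_l2_reindex:
  assumes "bij_betw \<sigma> X X"
  shows "(\<lambda>x. f (\<sigma> x)) \<in> real_l2 X \<longleftrightarrow> f \<in> real_l2 X"
  unfolding real_l2_def using summable_on_reindex_bij_betw[OF assms, of "\<lambda>x. (f x)\<^sup>2"] by simp

lemma ip_reindex:
  assumes "bij_betw \<sigma> X X"
  shows "ip X (\<lambda>x. f (\<sigma> x)) (\<lambda>x. g (\<sigma> x)) = ip X f g"
  unfolding ip_def using infsum_reindex_bij_betw[OF assms, of "\<lambda>x. f x * g x"] by simp

text \<open>Composing \<open>kernel (\<sigma> a)\<close> with \<open>\<sigma>\<close> gives a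
  function in \<open>V\<close> that reproduces evaluation at \<open>a\<close>, so uniqueness
  applies. The assumption \<open>lift\<close> is invariance of \<open>V\<close> under the inverse of
  \<open>\<sigma>\<close>, stated on \<open>X\<close> only.\<close>

lemma (in l2_subspace) kernel_invariant:
  assumes bij: "bij_betw \<sigma> X X" and \<sigma>: "\<And>v. v \<in> V \<Longrightarrow> (\<lambda>x. v (\<sigma> x)) \<in> V"
    and lift: "\<And>v. v \<in> V \<Longrightarrow> \<exists>w\<in>V. \<forall>x\<in>X. w (\<sigma> x) = v x"
    and a: "a \<in> X" and b: "b \<in> X"
  shows "kernel (\<sigma> a) (\<sigma> b) = kernel a b"
proof -
  have \<sigma>a: "\<sigma> a \<in> X" using bij a by (auto simp: bij_betw_def)
  have "ip X (\<lambda>y. kernel (\<sigma> a) (\<sigma> y)) v = v a" if v: "v \<in> V" for v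
  proof -
    obtain w where w: "w \<in> V" "\<And>x. x \<in> X \<Longrightarrow> w (\<sigma> x) = v x" using lift[OF v] by blast
    have "ip X (\<lambda>y. kernel (\<sigma> a) (\<sigma> y)) v = ip X (\<lambda>y. kernel (\<sigma> a) (\<sigma> y)) (\<lambda>y. w (\<sigma> y))"
      unfolding ip_def by (rule infsum_cong) (simp add: w(2))
    also have "\<dots> = ip X (kernel (\<sigma> a)) w" by (rule ip_reindex[OF bij])
    also have "\<dots> = w (\<sigma> a)" using \<sigma>a w(1) by (rule ip_kernel)
    finally show ?thesis using w(2) a by simp
  qed
  from kernel_unique[OF a \<sigma>[OF kernel_in[OF \<sigma>a]] this b] show ?thesis .
qed

text \<open>A condition on a finite sum survives pointwise limits. For an infinite member of
  \<open>\<A>\<close> it is vacuous, since \<open>sum\<close> is then 0 by convention.\<close>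

lemma finite_sum_conditions_l2_subspace:
  fixes X :: "'a set"
  assumes "\<And>A. A \<in> \<A> \<Longrightarrow> A \<subseteq> X"
  shows "l2_subspace X {f \<in> real_l2 X. \<forall>A\<in>\<A>. sum f A = 0}"
proof
  show "{f \<in> real_l2 X. \<forall>A\<in>\<A>. sum f A = 0} \<subseteq> real_l2 X" by auto
  show "(\<lambda>x. 0) \<in> {f \<in> real_l2 X. \<forall>A\<in>\<A>. sum f A = 0}" by (auto simp: real_l2_def)
next
  fix f g assume "f \<in> {f \<in> real_l2 X. \<forall>A\<in>\<A>. sum f A = 0}" "g \<in> {f \<in> real_l2 X. \<forall>A\<in>\<A>. sum f A = 0}"
  thus "(\<lambda>x. f x + g x) \<in> {f \<in> real_l2 X. \<forall>A\<in>\<A>. sum f A = 0}"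
    by (simp add: real_l2_add sum.distrib)
next
  fix f :: "'a \<Rightarrow> real" and c :: real
  assume "f \<in> {f \<in> real_l2 X. \<forall>A\<in>\<A>. sum f A = 0}"
  thus "(\<lambda>x. c * f x) \<in> {f \<in> real_l2 X. \<forall>A\<in>\<A>. sum f A = 0}"
    by (simp add: real_l2_scale flip: sum_distrib_left)
next
  fix F :: "nat \<Rightarrow> 'a \<Rightarrow> real" and f
  assume F: "\<And>n. F n \<in> {f \<in> real_l2 X. \<forall>A\<in>\<A>. sum f A = 0}"
    and lim: "\<And>x. x \<in> X \<Longrightarrow> (\<lambda>n. F n x) \<longlonglongrightarrow> f x" and f: "f \<in> real_l2 X"
  have "sum f A = 0" if A: "A \<in> \<A>" for A
  proof -
    have "(\<lambda>n. sum (F n) A) \<longlonglongrightarrow> sum f A"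
      using lim assms[OF A] by (intro tendsto_sum) auto
    moreover have "sum (F n) A = 0" for n using F A by simp
    ultimately show ?thesis by (simp add: LIMSEQ_const_iff)
  qed
  thus "f \<in> {f \<in> real_l2 X. \<forall>A\<in>\<A>. sum f A = 0}" using f by simp
qed

text \<open>Meant for infinite conjugacy classes, on which a function invariant under conjugation is
  constant.\<close>

lemma constant_on_infinite_zero:
  assumes f: "f \<in> real_l2 X" and A: "infinite A" "A \<subseteq> X" "\<And>x. x \<in> A \<Longrightarrow> f x = c"
  shows "c = 0"
proof (rule ccontr)
  assume "c \<noteq> 0"
  obtain n :: nat where n: "ip X f f / c\<^sup>2 < real n" using reals_Archimedean2 by blast
  obtain B where B: "finite B" "card B = n" "B \<subseteq> A" using infinite_arbitrarily_large[OF A(1)] by blast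
  have "real n * c\<^sup>2 = (\<Sum>x\<in>B. (f x)\<^sup>2)" using B A(3) by (simp add: subset_iff)
  also have "\<dots> \<le> ip X f f" using sum_squares_le_ip[OF f B(1)] B(3) A(2) by blast
  finally show False using n \<open>c \<noteq> 0\<close> by (simp add: field_simps)
qed

section \<open>Elements with finitely many conjugates\<close>

lemma finite_image_if_factors:
  assumes "finite (\<phi> ` A)" "\<And>p q. p \<in> A \<Longrightarrow> q \<in> A \<Longrightarrow> \<phi> p = \<phi> q \<Longrightarrow> f p = f q"
  shows "finite (f ` A)"
proof (rule finite_subset)
  show "f ` A \<subseteq> (\<lambda>t. f (inv_into A \<phi> t)) ` \<phi> ` A"
  proof
    fix u assume "u \<in> f ` A"
    then obtain p where p: "p \<in> A" "u = f p" by blast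
    have "inv_into A \<phi> (\<phi> p) \<in> A" "\<phi> (inv_into A \<phi> (\<phi> p)) = \<phi> p"
      using p(1) by (auto intro: inv_into_into f_inv_into_f)
    hence "u = f (inv_into A \<phi> (\<phi> p))" using assms(2) p by metis
    thus "u \<in> (\<lambda>t. f (inv_into A \<phi> t)) ` \<phi> ` A" using p(1) by blast
  qed
  show "finite ((\<lambda>t. f (inv_into A \<phi> t)) ` \<phi> ` A)" using assms(1) by simp
qed

context group
begin

lemma inv_mult_cancel: "x \<in> carrier G \<Longrightarrow> y \<in> carrier G \<Longrightarrow> inv x \<otimes> (x \<otimes> y) = y"
  by (simp flip: m_assoc)

lemma mult_inv_cancel: "x \<in> carrier G \<Longrightarrow> y \<in> carrier G \<Longrightarrow> x \<otimes> (inv x \<otimes> y) = y"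
  by (simp flip: m_assoc)

text \<open>Rules that bracket words to the right, distribute inverses and cancel neighbours, so
  that identities holding in every group are left to the simplifier.\<close>

lemmas group_normalize = m_assoc inv_mult_group inv_mult_cancel mult_inv_cancel

section \<open>Words and Dietzmann's argument\<close>

definition word_prod :: "'a list \<Rightarrow> 'a" where
  "word_prod ws = foldr (\<otimes>) ws \<one>"

lemma word_prod_simps [simp]:
  "word_prod [] = \<one>" "word_prod (a # ws) = a \<otimes> word_prod ws"
  by (simp_all add: word_prod_def)

lemma word_prod_closed [simp, intro]: "set ws \<subseteq> carrier G \<Longrightarrow> word_prod ws \<in> carrier G"
  by (induction ws) auto

lemma word_prod_append:
  "set us \<subseteq> carrier G \<Longrightarrow> set ws \<subseteq> carrier G \<Longrightarrow> word_prod (us @ ws) = word_prod us \<otimes> word_prod ws"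
  by (induction us) (auto simp: m_assoc)

lemma mult_nat_pow_commute: "c \<in> carrier G \<Longrightarrow> c \<otimes> c [^] (n::nat) = c [^] n \<otimes> c"
  using nat_pow_Suc2[of c n] by simp

lemma word_prod_replicate: "c \<in> carrier G \<Longrightarrow> word_prod (replicate n c) = c [^] n"
  by (induction n) (auto simp: mult_nat_pow_commute)

lemma conj_mult:
  "g \<in> carrier G \<Longrightarrow> x \<in> carrier G \<Longrightarrow> y \<in> carrier G \<Longrightarrow>
    inv g \<otimes> (x \<otimes> y) \<otimes> g = (inv g \<otimes> x \<otimes> g) \<otimes> (inv g \<otimes> y \<otimes> g)"
  by (simp add: group_normalize)

lemma conj_nat_pow:
  "g \<in> carrier G \<Longrightarrow> x \<in> carrier G \<Longrightarrow> (inv g \<otimes> x \<otimes> g) [^] (n::nat) = inv g \<otimes> x [^] n \<otimes> g"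
  by (induction n) (auto simp: group_normalize)

lemma conj_word_prod:
  "g \<in> carrier G \<Longrightarrow> set ws \<subseteq> carrier G \<Longrightarrow>
    inv g \<otimes> word_prod ws \<otimes> g = word_prod (map (\<lambda>x. inv g \<otimes> x \<otimes> g) ws)"
  by (induction ws) (auto simp: conj_mult)

lemma ex_pow_eq_one:
  assumes c: "c \<in> carrier G" and "finite A" "\<And>n::nat. c [^] n \<in> A"
  shows "\<exists>n>0. c [^] (n::nat) = \<one>"
proof -
  have "finite (range (\<lambda>n::nat. c [^] n))"
    using assms by (auto intro!: finite_subset[of "range _" A])
  hence "\<not> inj (\<lambda>n::nat. c [^] n)" using finite_imageD infinite_UNIV_nat by blast
  then obtain i j :: nat where "i < j" "c [^] i = c [^] j"
    unfolding inj_def by (metis nat_neq_iff)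
  have "c [^] i \<otimes> c [^] (j - i) = c [^] j"
    using c \<open>i < j\<close> by (simp add: nat_pow_mult)
  hence "c [^] i \<otimes> c [^] (j - i) = c [^] i \<otimes> \<one>"
    using c \<open>c [^] i = c [^] j\<close> by simp
  hence "c [^] (j - i) = \<one>" using c by (simp only: Units_l_cancel Units_eq nat_pow_closed one_closed)
  thus ?thesis using \<open>i < j\<close> by (intro exI[of _ "j - i"]) auto
qed

lemma conj_closed_nat_pow:
  assumes "C \<subseteq> carrier G" "\<And>a c. a \<in> C \<Longrightarrow> c \<in> C \<Longrightarrow> inv c \<otimes> a \<otimes> c \<in> C" "a \<in> C" "c \<in> C"
  shows "inv (c [^] (n::nat)) \<otimes> a \<otimes> c [^] n \<in> C"
proof (induction n)
  case 0
  thus ?case using assms by auto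
next
  case (Suc n)
  have cl: "a \<in> carrier G" "c \<in> carrier G" using assms by auto
  have "inv (c [^] Suc n) \<otimes> a \<otimes> c [^] Suc n = inv c \<otimes> (inv (c [^] n) \<otimes> a \<otimes> c [^] n) \<otimes> c"
    using cl by (simp add: group_normalize)
  thus ?case using Suc assms(2,4) by simp
qed

text \<open>\<open>a \<otimes> c [^] j = c [^] j \<otimes> b\<close> with
  \<open>b = inv (c [^] j) \<otimes> a \<otimes> c [^] j\<close>, again in \<open>C\<close>. Moving
  all letters \<open>c\<close> to the front thus preserves the length of the word.\<close>

lemma collect_letter_front:
  assumes C: "C \<subseteq> carrier G" and conj: "\<And>a c. a \<in> C \<Longrightarrow> c \<in> C \<Longrightarrow> inv c \<otimes> a \<otimes> c \<in> C"
    and c: "c \<in> C" and "set ws \<subseteq> C"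
  shows "\<exists>ws'. set ws' \<subseteq> C \<and> length ws' + count_list ws c = length ws \<and>
           word_prod ws = c [^] count_list ws c \<otimes> word_prod ws'"
  using assms(4)
proof (induction ws)
  case Nil
  show ?case by (intro exI[of _ "[]"]) simp
next
  case (Cons a ws)
  define j where "j = count_list ws c"
  obtain ws' where ws': "set ws' \<subseteq> C" "length ws' + j = length ws" "word_prod ws = c [^] j \<otimes> word_prod ws'"
    using Cons unfolding j_def by auto
  have cl: "a \<in> carrier G" "c \<in> carrier G" "word_prod ws' \<in> carrier G"
    using Cons.prems C c ws'(1) by (auto intro!: word_prod_closed)
  show ?case
  proof (cases "a = c")
    case True
    thus ?thesis using ws' cl
      by (intro exI[of _ ws']) (auto simp: j_def[symmetric] mult_nat_pow_commute simp flip: m_assoc)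
  next
    case False
    define b where "b = inv (c [^] j) \<otimes> a \<otimes> c [^] j"
    have "b \<in> C"
      unfolding b_def using conj_closed_nat_pow[OF C conj, of a c j] Cons.prems c by simp
    moreover have "a \<otimes> word_prod ws = c [^] j \<otimes> word_prod (b # ws')"
      using cl by (simp add: ws'(3) b_def group_normalize)
    ultimately show ?thesis using ws' False
      by (intro exI[of _ "b # ws'"]) (auto simp: j_def[symmetric])
  qed
qed

text \<open>Dietzmann's argument: in a word with more than \<open>m * card C\<close> letters some letter occurs \<open>m\<close> times;
  these occurrences can be moved to the front, conjugating the other letters, and then shortened.\<close>

lemma finite_word_prods:
  assumes fin: "finite C" and C: "C \<subseteq> carrier G"
    and conj: "\<And>a c. a \<in> C \<Longrightarrow> c \<in> C \<Longrightarrow> inv c \<otimes> a \<otimes> c \<in> C"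
    and short: "\<And>c. c \<in> C \<Longrightarrow> \<exists>us. set us \<subseteq> C \<and> length us < m \<and> c [^] m = word_prod us"
  shows "finite (word_prod ` {ws. set ws \<subseteq> C})"
proof -
  have bounded: "\<exists>ws'. set ws' \<subseteq> C \<and> length ws' \<le> m * card C \<and> word_prod ws = word_prod ws'"
    if "set ws \<subseteq> C" for ws
    using that
  proof (induction ws rule: length_induct)
    case (1 ws)
    show ?case
    proof (cases "length ws \<le> m * card C")
      case True
      thus ?thesis using 1 by blast
    next
      case False
      have "\<exists>c\<in>C. m \<le> count_list ws c"
      proof (rule ccontr)
        assume "\<not> ?thesis"
        hence "(\<Sum>c\<in>C. count_list ws c) \<le> (\<Sum>c\<in>C. m)"
          by (intro sum_mono) (auto simp: not_le less_imp_le)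
        thus False using False sum_count_set[OF "1.prems" fin] by (simp add: mult.commute)
      qed
      then obtain c where c: "c \<in> C" "m \<le> count_list ws c" by blast
      obtain ws' where ws': "set ws' \<subseteq> C" "length ws' + count_list ws c = length ws"
        "word_prod ws = c [^] count_list ws c \<otimes> word_prod ws'"
        using collect_letter_front[OF C conj c(1) "1.prems"] by blast
      \<comment> \<open>In the two applications \<open>us\<close> is the empty word (letters with
        \<open>c [^] m = \<one>\<close>) and a word of \<open>m - 1\<close> commutators
        (Schur).\<close>
      obtain us where us: "set us \<subseteq> C" "length us < m" "c [^] m = word_prod us"
        using short[OF c(1)] by blast
      define vs where "vs = us @ replicate (count_list ws c - m) c @ ws'"
      have cl: "c \<in> carrier G" "set us \<subseteq> carrier G" "set ws' \<subseteq> carrier G"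
        using C c us ws' by auto
      have "c [^] count_list ws c = c [^] m \<otimes> c [^] (count_list ws c - m)"
        using cl c(2) by (simp add: nat_pow_mult)
      moreover have "set (replicate (count_list ws c - m) c) \<subseteq> carrier G"
        using cl by auto
      ultimately have "word_prod ws = word_prod vs"
        unfolding ws'(3) vs_def using cl
        by (simp add: word_prod_append word_prod_replicate us(3) m_assoc)
      moreover have "length vs < length ws" "set vs \<subseteq> C"
        using us ws' c by (auto simp: vs_def)
      ultimately show ?thesis using "1.IH" by metis
    qed
  qed
  have "word_prod ` {ws. set ws \<subseteq> C} \<subseteq> word_prod ` {ws. set ws \<subseteq> C \<and> length ws \<le> m * card C}"
    using bounded by fast
  thus ?thesis
    using finite_lists_length_le[OF fin] finite_subset by blast
qed

section \<open>The FC-centre and its torsion elements\<close>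

definition conj_class :: "'a \<Rightarrow> 'a set" where
  "conj_class x = (\<lambda>g. inv g \<otimes> x \<otimes> g) ` carrier G"

text \<open>The group called \<Delta> in the overview.\<close>

definition fc_center :: "'a set" where
  "fc_center = {x \<in> carrier G. finite (conj_class x)}"

lemma conj_in_class: "g \<in> carrier G \<Longrightarrow> inv g \<otimes> x \<otimes> g \<in> conj_class x"
  by (auto simp: conj_class_def)

lemma conj_class_closed: "x \<in> carrier G \<Longrightarrow> conj_class x \<subseteq> carrier G"
  by (auto simp: conj_class_def)

lemma self_in_class: "x \<in> carrier G \<Longrightarrow> x \<in> conj_class x"
  using conj_in_class[of \<one> x] by simp

lemma conj_class_conj:
  assumes "x \<in> carrier G" "y \<in> conj_class x" "g \<in> carrier G"
  shows "inv g \<otimes> y \<otimes> g \<in> conj_class x"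
proof -
  obtain h where h: "h \<in> carrier G" "y = inv h \<otimes> x \<otimes> h"
    using assms(2) by (auto simp: conj_class_def)
  hence "inv g \<otimes> y \<otimes> g = inv (h \<otimes> g) \<otimes> x \<otimes> (h \<otimes> g)"
    using assms by (simp add: group_normalize)
  thus ?thesis using conj_in_class[of "h \<otimes> g" x] h assms by simp
qed

lemma fc_center_subgroup: "subgroup fc_center G"
proof (rule subgroupI)
  show "fc_center \<subseteq> carrier G" by (auto simp: fc_center_def)
  have "conj_class \<one> \<subseteq> {\<one>}" by (auto simp: conj_class_def)
  hence "finite (conj_class \<one>)" using finite_subset by auto
  thus "fc_center \<noteq> {}" by (auto simp: fc_center_def)
next
  fix x assume x: "x \<in> fc_center"
  have "conj_class (inv x) \<subseteq> (\<lambda>y. inv y) ` conj_class x"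
  proof
    fix y assume "y \<in> conj_class (inv x)"
    then obtain g where g: "g \<in> carrier G" "y = inv g \<otimes> inv x \<otimes> g"
      by (auto simp: conj_class_def)
    hence "y = inv (inv g \<otimes> x \<otimes> g)" using x by (simp add: fc_center_def group_normalize)
    thus "y \<in> (\<lambda>y. inv y) ` conj_class x" using conj_in_class g by blast
  qed
  moreover have "finite ((\<lambda>y. inv y) ` conj_class x)" using x by (simp add: fc_center_def)
  ultimately have "finite (conj_class (inv x))" by (rule finite_subset)
  thus "inv x \<in> fc_center" using x by (simp add: fc_center_def)
next
  fix x y assume xy: "x \<in> fc_center" "y \<in> fc_center"
  have "conj_class (x \<otimes> y) \<subseteq> (\<lambda>(a, b). a \<otimes> b) ` (conj_class x \<times> conj_class y)"
  proof
    fix z assume "z \<in> conj_class (x \<otimes> y)"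
    then obtain g where g: "g \<in> carrier G" "z = inv g \<otimes> (x \<otimes> y) \<otimes> g"
      by (auto simp: conj_class_def)
    hence "z = (inv g \<otimes> x \<otimes> g) \<otimes> (inv g \<otimes> y \<otimes> g)"
      using xy by (simp add: conj_mult fc_center_def)
    thus "z \<in> (\<lambda>(a, b). a \<otimes> b) ` (conj_class x \<times> conj_class y)"
      using conj_in_class[OF g(1)] by force
  qed
  moreover have "finite ((\<lambda>(a, b). a \<otimes> b) ` (conj_class x \<times> conj_class y))"
    using xy by (auto simp: fc_center_def)
  ultimately have "finite (conj_class (x \<otimes> y))" by (rule finite_subset)
  thus "x \<otimes> y \<in> fc_center" using xy by (simp add: fc_center_def)
qed

text \<open>Dietzmann's lemma. \<open>N\<close> consists of the words in the conjugates of
  \<open>x\<close>; these are permuted by conjugation and have trivial \<open>n\<close>-th power, so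
  \<open>N\<close> is finite. Words contain no inverses, but in a finite set closed under products
  every inverse is a power.\<close>

lemma torsion_fc_in_finite_normal:
  assumes x: "x \<in> fc_center" and n: "n > 0" "x [^] (n::nat) = \<one>"
  shows "\<exists>N. normal N G \<and> finite N \<and> x \<in> N"
proof -
  let ?C = "conj_class x"
  have xc: "x \<in> carrier G" and fin: "finite ?C" using x by (auto simp: fc_center_def)
  have C: "?C \<subseteq> carrier G" using xc by (rule conj_class_closed)
  define N where "N = word_prod ` {ws. set ws \<subseteq> ?C}"
  have conj: "inv c \<otimes> a \<otimes> c \<in> ?C" if "a \<in> ?C" "c \<in> carrier G" for a c
    using conj_class_conj xc that by blast
  have "c [^] n = \<one>" if "c \<in> ?C" for c
    using that n xc by (auto simp: conj_class_def conj_nat_pow)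
  hence "\<exists>us. set us \<subseteq> ?C \<and> length us < n \<and> c [^] n = word_prod us" if "c \<in> ?C" for c
    using that n(1) by (intro exI[of _ "[]"]) auto
  hence finN: "finite N"
    unfolding N_def using fin C conj by (intro finite_word_prods) auto
  have Nc: "N \<subseteq> carrier G" using C by (auto simp: N_def)
  have Nm: "a \<otimes> b \<in> N" if ab: "a \<in> N" "b \<in> N" for a b
  proof -
    obtain us ws where "set us \<subseteq> ?C" "a = word_prod us" "set ws \<subseteq> ?C" "b = word_prod ws"
      using ab by (auto simp: N_def)
    hence "a \<otimes> b = word_prod (us @ ws)" "set (us @ ws) \<subseteq> ?C"
      using C by (auto simp: word_prod_append)
    thus ?thesis by (auto simp: N_def)
  qed
  have N1: "\<one> \<in> N" unfolding N_def by (intro image_eqI[of _ _ "[]"]) auto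
  have Np: "a [^] (k::nat) \<in> N" if "a \<in> N" for a k
    using that N1 Nm by (induction k) auto
  have "subgroup N G"
  proof (rule subgroupI)
    fix a assume a: "a \<in> N"
    then obtain k :: nat where k: "k > 0" "a [^] k = \<one>"
      using ex_pow_eq_one[of a N] Np finN Nc by blast
    then obtain j where "k = Suc j" using gr0_conv_Suc by blast
    hence "inv a = a [^] j"
      using k a Nc inv_equality[of "a [^] j" a] by auto
    thus "inv a \<in> N" using Np a by simp
  qed (use N1 Nc Nm in auto)
  moreover have "g \<otimes> a \<otimes> inv g \<in> N" if g: "g \<in> carrier G" and a: "a \<in> N" for g a
  proof -
    obtain ws where ws: "set ws \<subseteq> ?C" "a = word_prod ws" using a by (auto simp: N_def)
    have "g \<otimes> a \<otimes> inv g = word_prod (map (\<lambda>x. inv (inv g) \<otimes> x \<otimes> inv g) ws)"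
      using conj_word_prod[of "inv g" ws] g ws C by auto
    moreover have "set (map (\<lambda>x. inv (inv g) \<otimes> x \<otimes> inv g) ws) \<subseteq> ?C"
      using conj[of _ "inv g"] g ws(1) by auto
    ultimately show ?thesis unfolding N_def by blast
  qed
  ultimately have "normal N G" by (auto simp: normal_inv_iff)
  moreover have "x \<in> N"
    unfolding N_def using self_in_class[OF xc] xc by (intro image_eqI[of _ _ "[x]"]) auto
  ultimately show ?thesis using finN by blast
qed

section \<open>Schur's argument for commutators in the FC-centre\<close>

lemma conj_eq_iff_commute:
  assumes "g \<in> carrier G" "x \<in> carrier G"
  shows "inv g \<otimes> x \<otimes> g = x \<longleftrightarrow> g \<otimes> x = x \<otimes> g"
  using assms by (metis inv_closed inv_solve_left' m_assoc m_closed)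

text \<open>Let \<open>r\<close> be the size of the class of \<open>x\<close>. Among the conjugates
  of \<open>x\<close> by \<open>g [^] 0\<close>, ..., \<open>g [^] r\<close> two coincide, so
  \<open>g [^] d\<close> commutes with \<open>x\<close> for some \<open>d\<close> between 1 and
  \<open>r\<close>. The factorial of \<open>r\<close> is a multiple of every such \<open>d\<close>,
  hence serves all \<open>g\<close> at once.\<close>

lemma fc_common_commuting_power:
  assumes x: "x \<in> fc_center"
  shows "\<exists>n>0. \<forall>g\<in>carrier G. g [^] (n::nat) \<otimes> x = x \<otimes> g [^] n"
proof -
  have xc: "x \<in> carrier G" and fin: "finite (conj_class x)" using x by (auto simp: fc_center_def)
  let ?r = "card (conj_class x)"
  have "g [^] (fact ?r :: nat) \<otimes> x = x \<otimes> g [^] (fact ?r :: nat)" if g: "g \<in> carrier G" for g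
  proof -
    let ?\<phi> = "\<lambda>i::nat. inv (g [^] i) \<otimes> x \<otimes> g [^] i"
    have "?\<phi> ` {..?r} \<subseteq> conj_class x" using g by (auto intro: conj_in_class)
    hence "card (?\<phi> ` {..?r}) \<le> ?r" using fin card_mono by blast
    hence "\<not> inj_on ?\<phi> {..?r}" using card_image[of ?\<phi> "{..?r}"] by auto
    then obtain i j where ij: "i < j" "j \<le> ?r" "?\<phi> i = ?\<phi> j"
      unfolding inj_on_def by (metis atMost_iff nat_neq_iff)
    define d where "d = j - i"
    have gj: "g [^] j = g [^] d \<otimes> g [^] i" using g ij by (simp add: nat_pow_mult d_def)
    have "inv (g [^] i) \<otimes> x \<otimes> g [^] i = inv (g [^] i) \<otimes> (inv (g [^] d) \<otimes> x \<otimes> g [^] d) \<otimes> g [^] i"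
      using ij(3) g xc unfolding gj by (simp add: group_normalize)
    hence "inv (g [^] d) \<otimes> x \<otimes> g [^] d = x"
      using g xc by simp
    hence comm: "g [^] d \<otimes> x = x \<otimes> g [^] d"
      using g xc conj_eq_iff_commute[of "g [^] d" x] by simp
    have "d dvd fact ?r" using ij by (intro dvd_fact) (auto simp: d_def)
    then obtain k where k: "fact ?r = d * k" by blast
    have "(g [^] d) [^] k \<otimes> x = x \<otimes> (g [^] d) [^] k"
      using comm g xc by (induction k) (simp_all add: m_assoc, simp flip: m_assoc)
    thus ?thesis using g by (simp add: k nat_pow_pow)
  qed
  thus ?thesis by (intro exI[of _ "fact ?r"]) auto
qed

definition commutator :: "'a \<Rightarrow> 'a \<Rightarrow> 'a" where
  "commutator a b = inv a \<otimes> inv b \<otimes> a \<otimes> b"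

lemma commutator_closed [simp]:
  "a \<in> carrier G \<Longrightarrow> b \<in> carrier G \<Longrightarrow> commutator a b \<in> carrier G"
  by (simp add: commutator_def)

lemma commutator_unique:
  assumes "a \<in> carrier G" "b \<in> carrier G" "t \<in> carrier G" "b \<otimes> a \<otimes> t = a \<otimes> b"
  shows "t = commutator a b"
proof -
  have "inv (b \<otimes> a) \<otimes> (b \<otimes> a \<otimes> t) = commutator a b"
    unfolding assms(4) using assms by (simp add: commutator_def group_normalize)
  thus ?thesis using assms(1-3) by (simp add: group_normalize)
qed

lemma conj_commutator:
  "a \<in> carrier G \<Longrightarrow> b \<in> carrier G \<Longrightarrow> h \<in> carrier G \<Longrightarrow>
    inv h \<otimes> commutator a b \<otimes> h = commutator (inv h \<otimes> a \<otimes> h) (inv h \<otimes> b \<otimes> h)"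
  by (simp add: commutator_def group_normalize)

text \<open>Schur's identity: \<open>n + 1\<close> equal commutators are replaced by \<open>n\<close> commutators.\<close>

lemma commutator_pow_Suc:
  assumes ab: "a \<in> carrier G" "b \<in> carrier G" and n: "n > 0"
    and central: "commutator a b [^] (n::nat) \<otimes> b = b \<otimes> commutator a b [^] n"
  shows "commutator a b [^] Suc n
    = commutator a (b \<otimes> b) \<otimes> commutator (inv b \<otimes> a \<otimes> b) b [^] (n - 1)"
proof -
  define c where "c = commutator a b"
  have cc: "c \<in> carrier G" using ab by (simp add: c_def)
  obtain m where m: "n = Suc m" using n gr0_conv_Suc by blast
  have "commutator (inv b \<otimes> a \<otimes> b) b = inv b \<otimes> c \<otimes> b"
    using ab by (simp add: c_def commutator_def group_normalize)
  hence pow: "commutator (inv b \<otimes> a \<otimes> b) b [^] (n - 1) = inv b \<otimes> c [^] m \<otimes> b"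
    using ab cc by (simp add: conj_nat_pow m)
  have two: "commutator a (b \<otimes> b) = inv a \<otimes> inv b \<otimes> a \<otimes> c \<otimes> b"
    using ab by (simp add: c_def commutator_def group_normalize)
  have "c [^] Suc n = c \<otimes> c [^] n" using cc by (simp add: mult_nat_pow_commute)
  also have "\<dots> = inv a \<otimes> inv b \<otimes> a \<otimes> (b \<otimes> c [^] n)"
    using ab cc by (simp add: c_def commutator_def m_assoc)
  \<comment> \<open>After \<open>b\<close> has passed the central power, one factor \<open>c\<close>
    completes \<open>commutator a (b \<otimes> b)\<close> and the other \<open>m\<close> form the
    conjugated power.\<close>
  also have "b \<otimes> c [^] n = c \<otimes> c [^] m \<otimes> b"
    using central cc unfolding c_def[symmetric] m by (simp add: mult_nat_pow_commute)
  also have "inv a \<otimes> inv b \<otimes> a \<otimes> (c \<otimes> c [^] m \<otimes> b) = commutator a (b \<otimes> b) \<otimes> (inv b \<otimes> c [^] m \<otimes> b)"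
    unfolding two using ab cc by (simp add: group_normalize)
  finally show ?thesis unfolding pow c_def .
qed

lemma commute_generate:
  assumes z: "z \<in> carrier G" and S: "S \<subseteq> carrier G" "\<And>s. s \<in> S \<Longrightarrow> z \<otimes> s = s \<otimes> z"
    and h: "h \<in> generate G S"
  shows "z \<otimes> h = h \<otimes> z"
proof -
  have "subgroup {h \<in> carrier G. z \<otimes> h = h \<otimes> z} G"
  proof (rule subgroupI)
    fix a assume "a \<in> {h \<in> carrier G. z \<otimes> h = h \<otimes> z}"
    hence a: "a \<in> carrier G" "z \<otimes> a = a \<otimes> z" by auto
    have "inv a \<otimes> (z \<otimes> a) \<otimes> inv a = inv a \<otimes> (a \<otimes> z) \<otimes> inv a" using a by simp
    hence "z \<otimes> inv a = inv a \<otimes> z"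
      using a(1) z by (simp add: group_normalize)
    thus "inv a \<in> {h \<in> carrier G. z \<otimes> h = h \<otimes> z}" using a(1) by simp
  next
    fix a b assume "a \<in> {h \<in> carrier G. z \<otimes> h = h \<otimes> z}" "b \<in> {h \<in> carrier G. z \<otimes> h = h \<otimes> z}"
    hence ab: "a \<in> carrier G" "z \<otimes> a = a \<otimes> z" "b \<in> carrier G" "z \<otimes> b = b \<otimes> z" by auto
    have "z \<otimes> (a \<otimes> b) = a \<otimes> (z \<otimes> b)" using ab(1-3) z by (simp flip: m_assoc)
    also have "\<dots> = a \<otimes> b \<otimes> z" using ab z by (simp add: m_assoc)
    finally show "a \<otimes> b \<in> {h \<in> carrier G. z \<otimes> h = h \<otimes> z}" using ab by simp
  qed (use z in auto)
  moreover have "S \<subseteq> {h \<in> carrier G. z \<otimes> h = h \<otimes> z}" using S by auto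
  ultimately show ?thesis using generate_subgroup_incl h by blast
qed

text \<open>Schur's theorem for the subgroup \<open>H\<close> generated by \<open>x\<close> and
  \<open>y\<close>: its centre has finite index, so it has finitely many commutators, and
  \<open>finite_word_prods\<close> bounds the set of their products. The powers of
  \<open>commutator x y\<close> lie in this finite set.\<close>

lemma commutator_fc_torsion:
  assumes x: "x \<in> fc_center" and y: "y \<in> fc_center"
  shows "\<exists>k>0. commutator x y [^] (k::nat) = \<one>"
proof -
  have xy: "x \<in> carrier G" "y \<in> carrier G" "finite (conj_class x)" "finite (conj_class y)"
    using x y by (auto simp: fc_center_def)
  define H where "H = generate G {x, y}"
  have H: "subgroup H G" unfolding H_def using xy by (intro generate_is_subgroup) auto
  have Hc: "H \<subseteq> carrier G" using subgroup.subset[OF H] .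
  have Hm: "\<And>a b. a \<in> H \<Longrightarrow> b \<in> H \<Longrightarrow> a \<otimes> b \<in> H" and Hi: "\<And>a. a \<in> H \<Longrightarrow> inv a \<in> H"
    using H by (simp_all add: subgroup.m_closed subgroup.m_inv_closed)
  have xyH: "x \<in> H" "y \<in> H" unfolding H_def by (auto intro: generate.incl)
  have central: "z \<otimes> h = h \<otimes> z"
    if "z \<in> carrier G" "z \<otimes> x = x \<otimes> z" "z \<otimes> y = y \<otimes> z" "h \<in> H" for z h
    by (rule commute_generate[of z "{x, y}"]) (use that xy in \<open>auto simp: H_def\<close>)
  define C where "C = (\<lambda>(a, b). commutator a b) ` (H \<times> H)"
  have C: "C \<subseteq> carrier G" using Hc by (auto simp: C_def intro!: commutator_closed)
  have finC: "finite C"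
    unfolding C_def
  proof (rule finite_image_if_factors)
    \<comment> \<open>\<open>?\<phi>\<close> records the cosets of the centre of \<open>H\<close>:
      if \<open>a\<close> and \<open>a'\<close> conjugate \<open>x\<close> and \<open>y\<close>
      alike, \<open>a' \<otimes> inv a\<close> commutes with \<open>x\<close> and \<open>y\<close>,
      hence with all of \<open>H\<close>.\<close>
    let ?\<phi> = "\<lambda>(a, b). ((inv a \<otimes> x \<otimes> a, inv a \<otimes> y \<otimes> a), (inv b \<otimes> x \<otimes> b, inv b \<otimes> y \<otimes> b))"
    have "?\<phi> ` (H \<times> H) \<subseteq> (conj_class x \<times> conj_class y) \<times> (conj_class x \<times> conj_class y)"
      using Hc conj_in_class by auto
    thus "finite (?\<phi> ` (H \<times> H))"
      by (rule finite_subset) (use xy in auto)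
    have quotient: "\<exists>z\<in>H. a' = z \<otimes> a \<and> (\<forall>h\<in>H. z \<otimes> h = h \<otimes> z)"
      if a: "a \<in> H" "a' \<in> H" and eq: "inv a \<otimes> x \<otimes> a = inv a' \<otimes> x \<otimes> a'" "inv a \<otimes> y \<otimes> a = inv a' \<otimes> y \<otimes> a'"
      for a a'
    proof -
      define z where "z = a' \<otimes> inv a"
      have ac: "a \<in> carrier G" "a' \<in> carrier G" using a Hc by auto
      have comm: "z \<otimes> u = u \<otimes> z" if u: "u \<in> carrier G" and eq: "inv a \<otimes> u \<otimes> a = inv a' \<otimes> u \<otimes> a'" for u
      proof -
        have "a' \<otimes> (inv a \<otimes> u \<otimes> a) \<otimes> inv a = a' \<otimes> (inv a' \<otimes> u \<otimes> a') \<otimes> inv a"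
          unfolding eq ..
        thus ?thesis using ac u by (simp add: z_def group_normalize)
      qed
      have "z \<in> H" using a Hm Hi by (simp add: z_def)
      moreover have "a' = z \<otimes> a" using ac by (simp add: z_def group_normalize)
      moreover have "\<forall>h\<in>H. z \<otimes> h = h \<otimes> z"
        using central[of z] comm[OF xy(1) eq(1)] comm[OF xy(2) eq(2)] ac by (auto simp: z_def)
      ultimately show ?thesis by blast
    qed
    fix p q assume p: "p \<in> H \<times> H" and q: "q \<in> H \<times> H" and eq: "?\<phi> p = ?\<phi> q"
    obtain a b a' b' where pq: "p = (a, b)" "q = (a', b')" by fastforce
    have ab: "a \<in> H" "b \<in> H" "a' \<in> H" "b' \<in> H" using p q pq by auto
    obtain z where z: "z \<in> H" "a' = z \<otimes> a" "\<And>h. h \<in> H \<Longrightarrow> z \<otimes> h = h \<otimes> z"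
      using quotient[of a a'] ab eq pq by auto
    obtain w where w: "w \<in> H" "b' = w \<otimes> b" "\<And>h. h \<in> H \<Longrightarrow> w \<otimes> h = h \<otimes> w"
      using quotient[of b b'] ab eq pq by auto
    have cl: "a \<in> carrier G" "b \<in> carrier G" "z \<in> carrier G" "w \<in> carrier G" using ab z w Hc by auto
    \<comment> \<open>The central factors \<open>z\<close> and \<open>w\<close> cancel in the
      commutator.\<close>
    have "commutator a b = commutator a' b'"
    proof (rule commutator_unique)
      have "b' \<otimes> a' \<otimes> commutator a b = w \<otimes> (b \<otimes> z) \<otimes> (a \<otimes> commutator a b)"
        using cl by (simp add: z w m_assoc)
      also have "b \<otimes> z = z \<otimes> b" using z(3) ab by simp
      also have "w \<otimes> (z \<otimes> b) \<otimes> (a \<otimes> commutator a b) = w \<otimes> z \<otimes> a \<otimes> b"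
        using cl by (simp add: commutator_def group_normalize)
      also have "\<dots> = z \<otimes> (w \<otimes> a) \<otimes> b"
        using cl z(3)[OF w(1)] by (simp flip: m_assoc)
      also have "\<dots> = a' \<otimes> b'"
        using cl by (simp add: w(3)[OF ab(1)] z(2) w(2) m_assoc)
      finally show "b' \<otimes> a' \<otimes> commutator a b = a' \<otimes> b'" .
    qed (use ab Hc in \<open>auto intro!: commutator_closed\<close>)
    thus "(\<lambda>(a, b). commutator a b) p = (\<lambda>(a, b). commutator a b) q" by (simp add: pq)
  qed
  obtain n1 :: nat where n1: "n1 > 0" "\<And>g. g \<in> carrier G \<Longrightarrow> g [^] n1 \<otimes> x = x \<otimes> g [^] n1"
    using fc_common_commuting_power[OF x] by blast
  obtain n2 :: nat where n2: "n2 > 0" "\<And>g. g \<in> carrier G \<Longrightarrow> g [^] n2 \<otimes> y = y \<otimes> g [^] n2"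
    using fc_common_commuting_power[OF y] by blast
  \<comment> \<open>A common multiple, so that every \<open>n\<close>-th power commutes with both
    generators of \<open>H\<close>, as Schur's identity requires.\<close>
  define n where "n = n1 * n2"
  have n: "n > 0" using n1 n2 by (simp add: n_def)
  have pow_central: "g [^] n \<otimes> h = h \<otimes> g [^] n" if g: "g \<in> carrier G" and h: "h \<in> H" for g h
  proof (rule central)
    show "g [^] n \<otimes> x = x \<otimes> g [^] n"
      using n1(2)[of "g [^] n2"] g by (simp add: n_def nat_pow_pow mult.commute)
    show "g [^] n \<otimes> y = y \<otimes> g [^] n"
      using n2(2)[of "g [^] n1"] g by (simp add: n_def nat_pow_pow)
  qed (use g h in auto)
  have commC: "commutator a b \<in> C" if "a \<in> H" "b \<in> H" for a b
    using that by (auto simp: C_def)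
  have "finite (word_prod ` {ws. set ws \<subseteq> C})"
  proof (rule finite_word_prods[OF finC C])
    fix u v assume "u \<in> C" "v \<in> C"
    then obtain a b where ab: "a \<in> H" "b \<in> H" "u = commutator a b" by (auto simp: C_def)
    have "v \<in> H" using \<open>v \<in> C\<close> Hm Hi by (auto simp: C_def commutator_def)
    hence "inv v \<otimes> u \<otimes> v = commutator (inv v \<otimes> a \<otimes> v) (inv v \<otimes> b \<otimes> v)"
      using ab Hc by (simp add: conj_commutator subset_iff)
    thus "inv v \<otimes> u \<otimes> v \<in> C" using ab \<open>v \<in> H\<close> Hm Hi by (auto intro!: commC)
  next
    fix c assume "c \<in> C"
    then obtain a b where ab: "a \<in> H" "b \<in> H" "c = commutator a b" by (auto simp: C_def)
    have abc: "a \<in> carrier G" "b \<in> carrier G" using ab Hc by auto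
    let ?us = "commutator a (b \<otimes> b) # replicate (n - 1) (commutator (inv b \<otimes> a \<otimes> b) b)"
    have "c [^] Suc n = word_prod ?us"
      using commutator_pow_Suc[OF abc n pow_central] ab abc by (simp add: word_prod_replicate)
    moreover have "set ?us \<subseteq> C" using ab Hm Hi by (auto intro!: commC)
    moreover have "length ?us < Suc n" using n by simp
    ultimately show "\<exists>us. set us \<subseteq> C \<and> length us < Suc n \<and> c [^] Suc n = word_prod us" by blast
  qed
  moreover have "commutator x y [^] (k::nat) \<in> word_prod ` {ws. set ws \<subseteq> C}" for k
  proof (rule image_eqI)
    show "commutator x y [^] k = word_prod (replicate k (commutator x y))"
      using xy by (simp add: word_prod_replicate)
    show "replicate k (commutator x y) \<in> {ws. set ws \<subseteq> C}" using commC xyH by auto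
  qed
  ultimately show ?thesis using ex_pow_eq_one xy by simp
qed

lemma fc_center_commute:
  assumes tf: "\<And>x n::nat. x \<in> fc_center \<Longrightarrow> n > 0 \<Longrightarrow> x [^] n = \<one> \<Longrightarrow> x = \<one>"
    and x: "x \<in> fc_center" and y: "y \<in> fc_center"
  shows "x \<otimes> y = y \<otimes> x"
proof -
  have xy: "x \<in> carrier G" "y \<in> carrier G" using x y by (auto simp: fc_center_def)
  have "commutator x y \<in> fc_center"
    unfolding commutator_def using x y fc_center_subgroup
    by (intro subgroup.m_closed subgroup.m_inv_closed)
  hence "commutator x y = \<one>" using commutator_fc_torsion[OF x y] tf by blast
  moreover have "y \<otimes> x \<otimes> commutator x y = x \<otimes> y"
    using xy by (simp add: commutator_def group_normalize)
  ultimately show ?thesis using xy by simp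
qed

end

section \<open>Torsion-free abelian groups\<close>

context comm_group
begin

section \<open>Ordering torsion-free abelian groups\<close>

definition torsion_free :: bool where
  "torsion_free \<longleftrightarrow> (\<forall>x\<in>carrier G. \<forall>n>0. x [^] (n::nat) = \<one> \<longrightarrow> x = \<one>)"

text \<open>Positive cones of translation invariant partial orders, where \<open>y\<close> is below
  \<open>x\<close> when \<open>x \<otimes> inv y \<in> P\<close>.\<close>

definition partial_cones :: "'a set set" where
  "partial_cones = {P. P \<subseteq> carrier G \<and> \<one> \<in> P \<and> (\<forall>a\<in>P. \<forall>b\<in>P. a \<otimes> b \<in> P) \<and> (\<forall>a\<in>P. inv a \<in> P \<longrightarrow> a = \<one>)}"

lemma cone_nat_pow: "P \<in> partial_cones \<Longrightarrow> a \<in> P \<Longrightarrow> a [^] (n::nat) \<in> P"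
  by (induction n) (auto simp: partial_cones_def)

text \<open>The monoid \<open>Q\<close> generated by \<open>P\<close> and \<open>y\<close> exceeds
  \<open>P\<close>, so it is no cone, and only antisymmetry can fail. Multiplying the expressions
  for some \<open>a \<noteq> \<one>\<close> and its inverse in \<open>Q\<close> gives
  \<open>q \<otimes> r \<otimes> y [^] (n + m) = \<one>\<close>.\<close>

lemma maximal_cone_inv_pow:
  assumes P: "P \<in> partial_cones" and max: "\<And>Q. Q \<in> partial_cones \<Longrightarrow> P \<subseteq> Q \<Longrightarrow> Q = P"
    and y: "y \<in> carrier G" "y \<notin> P"
  shows "\<exists>k>0. inv (y [^] (k::nat)) \<in> P"
proof -
  have Pc: "P \<subseteq> carrier G" and P1: "\<one> \<in> P" and Pm: "\<And>a b. a \<in> P \<Longrightarrow> b \<in> P \<Longrightarrow> a \<otimes> b \<in> P"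
    and Pa: "\<And>a. a \<in> P \<Longrightarrow> inv a \<in> P \<Longrightarrow> a = \<one>"
    using P by (auto simp: partial_cones_def)
  define Q where "Q = {q \<otimes> y [^] (n::nat) | q n. q \<in> P}"
  have PQ: "P \<subseteq> Q"
  proof
    fix q assume "q \<in> P"
    thus "q \<in> Q" unfolding Q_def using Pc by (intro CollectI exI[of _ q] exI[of _ 0]) auto
  qed
  have "y \<in> Q" unfolding Q_def using P1 y by (intro CollectI exI[of _ \<one>] exI[of _ 1]) auto
  hence "Q \<notin> partial_cones" using max PQ y(2) by blast
  moreover have "Q \<subseteq> carrier G" using Pc y by (auto simp: Q_def)
  moreover have "\<one> \<in> Q" using PQ P1 by blast
  moreover have "a \<otimes> b \<in> Q" if ab: "a \<in> Q" "b \<in> Q" for a b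
  proof -
    obtain q r :: 'a and n m :: nat where qr: "q \<in> P" "r \<in> P" "a = q \<otimes> y [^] n" "b = r \<otimes> y [^] m"
      using ab by (auto simp: Q_def)
    have cl: "q \<in> carrier G" "r \<in> carrier G" using qr Pc by auto
    have "a \<otimes> b = (q \<otimes> r) \<otimes> y [^] (n + m)"
      using cl y(1) by (simp add: qr nat_pow_mult[symmetric] m_ac)
    thus ?thesis using Pm[OF qr(1,2)] by (auto simp: Q_def)
  qed
  ultimately obtain a where a: "a \<in> Q" "inv a \<in> Q" "a \<noteq> \<one>"
    unfolding partial_cones_def by blast
  then obtain q r :: 'a and n m :: nat where qr: "q \<in> P" "r \<in> P" "a = q \<otimes> y [^] n" "inv a = r \<otimes> y [^] m"
    by (auto simp: Q_def)
  have cl: "q \<in> carrier G" "r \<in> carrier G" "a \<in> carrier G" using qr Pc y by auto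
  have "n + m \<noteq> 0"
  proof
    assume "n + m = 0"
    hence "a = q" "inv a = r" using qr cl by auto
    thus False using Pa[of a] qr a(3) by simp
  qed
  moreover have "(q \<otimes> r) \<otimes> y [^] (n + m) = \<one>"
  proof -
    have "(q \<otimes> r) \<otimes> y [^] (n + m) = a \<otimes> inv a"
      unfolding qr(4) unfolding qr(3) using cl y(1) by (simp add: nat_pow_mult[symmetric] m_ac)
    thus ?thesis using cl by simp
  qed
  hence "inv (y [^] (n + m)) = q \<otimes> r" using cl y(1) by (intro inv_equality) auto
  ultimately show ?thesis using Pm[OF qr(1,2)] by (intro exI[of _ "n + m"]) auto
qed

text \<open>Take a maximal cone by Zorn. If it contained neither \<open>x\<close> nor
  \<open>inv x\<close>, it would contain a negative power of each; raised to the common exponent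
  \<open>l * k\<close> these are mutually inverse, so \<open>x [^] (l * k) = \<one>\<close>.\<close>

lemma ex_total_cone:
  assumes tf: torsion_free
  shows "\<exists>P\<in>partial_cones. \<forall>x\<in>carrier G. x \<in> P \<or> inv x \<in> P"
proof -
  have "\<exists>P\<in>partial_cones. \<forall>Q\<in>partial_cones. P \<subseteq> Q \<longrightarrow> Q = P"
  proof (rule subset_Zorn_nonempty)
    have "{\<one>} \<in> partial_cones" by (simp add: partial_cones_def)
    thus "partial_cones \<noteq> {}" by blast
    fix \<C> assume ne: "\<C> \<noteq> {}" and chain: "subset.chain partial_cones \<C>"
    have sub: "P \<in> partial_cones" if "P \<in> \<C>" for P
      using chain that by (auto simp: subset_chain_def)
    have common: "\<exists>P\<in>\<C>. a \<in> P \<and> b \<in> P" if "a \<in> \<Union>\<C>" "b \<in> \<Union>\<C>" for a b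
    proof -
      obtain P Q where PQ: "P \<in> \<C>" "a \<in> P" "Q \<in> \<C>" "b \<in> Q" using \<open>a \<in> \<Union>\<C>\<close> \<open>b \<in> \<Union>\<C>\<close> by blast
      hence "P \<subseteq> Q \<or> Q \<subseteq> P" using chain by (simp add: subset_chain_def)
      thus ?thesis using PQ by blast
    qed
    show "\<Union>\<C> \<in> partial_cones"
      unfolding partial_cones_def
    proof (intro CollectI conjI ballI impI)
      show "\<Union>\<C> \<subseteq> carrier G" using sub unfolding partial_cones_def by blast
      show "\<one> \<in> \<Union>\<C>" using sub ne unfolding partial_cones_def by blast
    next
      fix a b assume ab: "a \<in> \<Union>\<C>" "b \<in> \<Union>\<C>"
      obtain P where "P \<in> \<C>" "a \<in> P" "b \<in> P" using common[OF ab] by blast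
      thus "a \<otimes> b \<in> \<Union>\<C>" using sub[of P] by (auto simp: partial_cones_def)
    next
      fix a assume ab: "a \<in> \<Union>\<C>" "inv a \<in> \<Union>\<C>"
      obtain P where "P \<in> \<C>" "a \<in> P" "inv a \<in> P" using common[OF ab] by blast
      thus "a = \<one>" using sub[of P] by (auto simp: partial_cones_def)
    qed
  qed
  then obtain P where P: "P \<in> partial_cones" and max: "\<And>Q. Q \<in> partial_cones \<Longrightarrow> P \<subseteq> Q \<Longrightarrow> Q = P"
    by blast
  have "x \<in> P \<or> inv x \<in> P" if x: "x \<in> carrier G" for x
  proof (rule ccontr)
    assume n: "\<not> (x \<in> P \<or> inv x \<in> P)"
    obtain k :: nat where k: "k > 0" "inv (x [^] k) \<in> P"
      using maximal_cone_inv_pow[OF P max x] n by blast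
    obtain l :: nat where l: "l > 0" "inv (inv x [^] l) \<in> P"
      using maximal_cone_inv_pow[OF P max inv_closed[OF x]] n by blast
    have "x [^] l \<in> P" using l(2) x by (simp add: nat_pow_inv)
    hence "x [^] (l * k) \<in> P" using cone_nat_pow[OF P] x by (metis nat_pow_pow)
    moreover have "inv (x [^] (l * k)) \<in> P"
      using cone_nat_pow[OF P k(2), of l] x by (simp add: nat_pow_inv nat_pow_pow mult.commute)
    ultimately have "x [^] (l * k) = \<one>" using P by (auto simp: partial_cones_def)
    hence "x = \<one>" using tf[unfolded torsion_free_def, rule_format, OF x, of "l * k"] k(1) l(1) by simp
    thus False using n P by (auto simp: partial_cones_def)
  qed
  thus ?thesis using P by blast
qed

text \<open>\<open>m\<close> is the greatest element of \<open>X\<close> in the total order with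
  cone \<open>P\<close>.\<close>

lemma ex_cone_max:
  assumes P: "P \<in> partial_cones" "\<And>x. x \<in> carrier G \<Longrightarrow> x \<in> P \<or> inv x \<in> P"
    and "finite X" "X \<noteq> {}" "X \<subseteq> carrier G"
  shows "\<exists>m\<in>X. \<forall>y\<in>X. m \<otimes> inv y \<in> P"
  using assms(3-5)
proof (induction X rule: finite_ne_induct)
  case (singleton x)
  thus ?case using P by (auto simp: partial_cones_def)
next
  case (insert x F)
  have Pm: "\<And>a b. a \<in> P \<Longrightarrow> b \<in> P \<Longrightarrow> a \<otimes> b \<in> P" and P1: "\<one> \<in> P"
    using P by (auto simp: partial_cones_def)
  obtain m where m: "m \<in> F" "\<And>y. y \<in> F \<Longrightarrow> m \<otimes> inv y \<in> P" using insert by auto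
  have cl: "x \<in> carrier G" "m \<in> carrier G" "F \<subseteq> carrier G" using insert m by auto
  show ?case
  proof (cases "x \<otimes> inv m \<in> P")
    case True
    have "x \<otimes> inv y \<in> P" if y: "y \<in> F" for y
    proof -
      have "x \<otimes> inv y = (x \<otimes> inv m) \<otimes> (m \<otimes> inv y)"
        using cl y by (simp add: group_normalize subset_iff)
      thus ?thesis using Pm True m(2) y by simp
    qed
    thus ?thesis using cl P1 by (intro bexI[of _ x]) auto
  next
    case False
    hence "inv (x \<otimes> inv m) \<in> P" using P(2)[of "x \<otimes> inv m"] cl by simp
    hence "m \<otimes> inv x \<in> P" using cl by (simp add: inv_mult_group)
    thus ?thesis using m by (intro bexI[of _ m]) auto
  qed
qed

text \<open>With \<open>m\<close> the greatest element of \<open>W\<close> and \<open>s\<close> the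
  least of \<open>S\<close> (found as the greatest inverse), \<open>g = m \<otimes> inv s\<close>
  moves \<open>s\<close> to \<open>m\<close> and every other point of \<open>S\<close> above
  \<open>m\<close>, hence out of \<open>W\<close>. This is the argument that an ordered group has no
  zero divisors in its group ring.\<close>

lemma ex_unique_translate_point:
  assumes tf: torsion_free and S: "finite S" "S \<noteq> {}" "S \<subseteq> carrier G"
    and W: "finite W" "W \<noteq> {}" "W \<subseteq> carrier G"
  shows "\<exists>g\<in>carrier G. \<exists>s\<in>S. g \<otimes> s \<in> W \<and> (\<forall>t\<in>S. g \<otimes> t \<in> W \<longrightarrow> t = s)"
proof -
  obtain P where P: "P \<in> partial_cones" "\<And>x. x \<in> carrier G \<Longrightarrow> x \<in> P \<or> inv x \<in> P"
    using ex_total_cone[OF tf] by blast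
  obtain m where m: "m \<in> W" "\<And>y. y \<in> W \<Longrightarrow> m \<otimes> inv y \<in> P" using ex_cone_max[OF P W] by blast
  obtain z where z: "z \<in> (\<lambda>s. inv s) ` S" "\<And>y. y \<in> (\<lambda>s. inv s) ` S \<Longrightarrow> z \<otimes> inv y \<in> P"
    using ex_cone_max[OF P, of "(\<lambda>s. inv s) ` S"] S by auto
  obtain s where s: "s \<in> S" "z = inv s" using z(1) by blast
  have cl: "m \<in> carrier G" "s \<in> carrier G" using m s W S by auto
  define g where "g = m \<otimes> inv s"
  have "t = s" if t: "t \<in> S" "g \<otimes> t \<in> W" for t
  proof -
    have tc: "t \<in> carrier G" using t S by auto
    have "inv s \<otimes> inv (inv t) \<in> P" using z(2)[of "inv t"] t s by auto
    hence "inv s \<otimes> t \<in> P" using tc by simp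
    moreover have "m \<otimes> inv (g \<otimes> t) \<in> P" using m t by auto
    moreover have "m \<otimes> inv (g \<otimes> t) = inv (inv s \<otimes> t)"
    proof -
      have "m \<otimes> inv (g \<otimes> t) = m \<otimes> (inv m \<otimes> inv (inv s \<otimes> t))"
        using cl tc by (simp add: g_def inv_mult m_assoc)
      thus ?thesis using cl tc by (simp add: mult_inv_cancel)
    qed
    ultimately have "inv s \<otimes> t = \<one>" using P(1) by (auto simp: partial_cones_def)
    hence "s \<otimes> (inv s \<otimes> t) = s \<otimes> \<one>" by simp
    thus ?thesis using cl tc by (simp add: group_normalize)
  qed
  moreover have "g \<otimes> s = m" "g \<in> carrier G" using cl by (simp_all add: g_def group_normalize)
  ultimately show ?thesis using m(1) s(1) by blast
qed

section \<open>Boxes and polynomial growth\<close>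

text \<open>These serve as Foelner sets: multiplication by an entry of \<open>ts\<close> leads from
  \<open>box n ts\<close> into \<open>box (Suc n) ts\<close>, so the difference of the two boxes
  acts as boundary.\<close>

primrec box :: "nat \<Rightarrow> 'a list \<Rightarrow> 'a set" where
  "box n [] = {\<one>}"
| "box n (t # ts) = (\<lambda>(i, q). t [^] i \<otimes> q) ` ({..n} \<times> box n ts)"

lemma finite_box: "finite (box n ts)"
  by (induction ts) auto

lemma card_box_le: "card (box n ts) \<le> (n + 1) ^ length ts"
proof (induction ts)
  case (Cons t ts)
  have "card (box n (t # ts)) \<le> card ({..n} \<times> box n ts)"
    using card_image_le[of "{..n} \<times> box n ts"] finite_box by simp
  also have "\<dots> = (n + 1) * card (box n ts)" by (simp add: card_cartesian_product)
  also have "\<dots> \<le> (n + 1) * (n + 1) ^ length ts" using Cons by (intro mult_left_mono) auto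
  finally show ?case by simp
qed simp

lemma box_closed: "set ts \<subseteq> carrier G \<Longrightarrow> box n ts \<subseteq> carrier G"
  by (induction ts) auto

lemma one_in_box: "\<one> \<in> box n ts"
proof (induction ts)
  case (Cons t ts)
  thus ?case by (auto intro!: image_eqI[of _ _ "(0, \<one>)"])
qed simp

lemma box_mono: "n \<le> m \<Longrightarrow> box n ts \<subseteq> box m ts"
  by (induction ts) fastforce+

lemma mult_in_box_Suc:
  assumes "set ts \<subseteq> carrier G" "t \<in> set ts" "q \<in> box n ts"
  shows "t \<otimes> q \<in> box (Suc n) ts"
  using assms
proof (induction ts arbitrary: q)
  case (Cons u ts)
  obtain i r where r: "i \<le> n" "r \<in> box n ts" "q = u [^] i \<otimes> r" using Cons.prems by auto
  have cl: "u \<in> carrier G" "r \<in> carrier G" "t \<in> carrier G" using Cons.prems r(2) box_closed[of ts n] by auto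
  show ?case
  proof (cases "t = u")
    case True
    have "t \<otimes> q = u [^] Suc i \<otimes> r" using cl by (simp add: r(3) True m_ac)
    moreover have "r \<in> box (Suc n) ts" using r(2) box_mono[of n "Suc n" ts] by auto
    ultimately show ?thesis using r(1) by (auto intro!: image_eqI[of _ _ "(Suc i, r)"])
  next
    case False
    hence "t \<otimes> r \<in> box (Suc n) ts" using Cons r(2) by auto
    moreover have "t \<otimes> q = u [^] i \<otimes> (t \<otimes> r)" using cl by (simp add: r(3) m_ac)
    ultimately show ?thesis using r(1) by (auto intro!: image_eqI[of _ _ "(i, t \<otimes> r)"])
  qed
qed simp

text \<open>Otherwise the cardinality would grow at least like the powers of
  \<open>1 / (1 - \<epsilon>)\<close>, against the polynomial bound
  \<open>card_box_le\<close>.\<close>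

lemma ex_box_small_boundary:
  assumes e: "\<epsilon> > 0"
  shows "\<exists>n. real (card (box (Suc n) ts)) - real (card (box n ts)) < \<epsilon> * real (card (box (Suc n) ts))"
proof (rule ccontr)
  define c where "c n = real (card (box n ts))" for n
  define r where "r = 1 - \<epsilon>"
  assume "\<not> ?thesis"
  hence step: "c n \<le> r * c (Suc n)" for n
    by (auto simp: c_def r_def not_less algebra_simps)
  have c1: "1 \<le> c n" for n
    using finite_box[of n ts] one_in_box[of n ts] card_0_eq[of "box n ts"]
    by (cases "card (box n ts)") (auto simp: c_def)
  \<comment> \<open>For \<open>\<epsilon> \<ge> 1\<close> the assumed failure is absurd at once
    because boxes are nonempty; this gives \<open>0 < r\<close>.\<close>
  have r: "0 < r" "r < 1"
  proof -
    show "r < 1" using e by (simp add: r_def)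
    have "0 < r * c 1" using step[of 0] c1[of 0] by simp
    thus "0 < r" using c1[of 1] by (simp add: zero_less_mult_iff)
  qed
  have "1 \<le> r ^ n * c n" for n
  proof (induction n)
    case 0
    thus ?case using c1 by simp
  next
    case (Suc n)
    have "r ^ n * c n \<le> r ^ n * (r * c (Suc n))" using step r by (intro mult_left_mono) auto
    thus ?case using Suc by (simp add: mult_ac)
  qed
  moreover have "c n \<le> real (n + 1) ^ length ts" for n
    using card_box_le[of n ts] unfolding c_def by (metis of_nat_le_iff of_nat_power)
  hence "r ^ n * c n \<le> r ^ n * real (n + 1) ^ length ts" for n
    using r by (intro mult_left_mono) auto
  ultimately have ge: "1 \<le> r ^ n * real (n + 1) ^ length ts" for n
    using order_trans by blast
  have "(\<lambda>n. r ^ n * real (n + 1) ^ length ts) \<longlonglongrightarrow> 0"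
    using r by real_asymp
  hence "1 \<le> (0::real)" using ge by (intro LIMSEQ_le_const) auto
  thus False by simp
qed

end

section \<open>Absence of square summable zero divisors\<close>

context group
begin

lemma sum_left_translate:
  assumes "g \<in> carrier G" "S \<subseteq> carrier G"
  shows "sum f ((\<lambda>s. g \<otimes> s) ` S) = (\<Sum>s\<in>S. f (g \<otimes> s))"
  by (rule sum.reindex_cong[of "\<lambda>s. g \<otimes> s"]) (use assms in \<open>auto simp: inj_on_def subset_iff\<close>)

lemma bij_betw_left_mult: "g \<in> carrier G \<Longrightarrow> bij_betw (\<lambda>x. g \<otimes> x) (carrier G) (carrier G)"
  by (rule bij_betw_byWitness[where f'="\<lambda>x. inv g \<otimes> x"]) (auto simp: group_normalize)

end

text \<open>The constant diagonal \<open>c\<close> is the von Neumann dimension of \<open>V\<close>.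
  If it were positive, \<open>sum_kernel_diag_le_card\<close> would fail for a box whose boundary
  has fewer than \<open>c\<close> times as many elements as the box.\<close>

lemma (in comm_group) torsion_free_l2_no_zero_divisors:
  assumes tf: torsion_free and S: "finite S" "S \<noteq> {}" "S \<subseteq> carrier G"
    and f: "f \<in> real_l2 (carrier G)" "\<And>g. g \<in> carrier G \<Longrightarrow> (\<Sum>s\<in>S. f (g \<otimes> s)) = 0"
    and x: "x \<in> carrier G"
  shows "f x = 0"
proof -
  define V where "V = {f \<in> real_l2 (carrier G). \<forall>A\<in>(\<lambda>g. (\<lambda>s. g \<otimes> s) ` S) ` carrier G. sum f A = 0}"
  interpret l2_subspace "carrier G" V
    unfolding V_def by (rule finite_sum_conditions_l2_subspace) (use S in \<open>auto simp: subset_iff\<close>)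
  have V_iff: "v \<in> V \<longleftrightarrow> v \<in> real_l2 (carrier G) \<and> (\<forall>g\<in>carrier G. (\<Sum>s\<in>S. v (g \<otimes> s)) = 0)" for v
    unfolding V_def using S by (simp add: sum_left_translate)
  have shift: "(\<lambda>y. v (h \<otimes> y)) \<in> V" if v: "v \<in> V" and h: "h \<in> carrier G" for v h
  proof -
    have "(\<Sum>s\<in>S. v (h \<otimes> (g \<otimes> s))) = (\<Sum>s\<in>S. v ((h \<otimes> g) \<otimes> s))" if "g \<in> carrier G" for g
      using that h S by (intro sum.cong) (auto simp: m_assoc)
    thus ?thesis
      using v h real_l2_reindex[OF bij_betw_left_mult[OF h], of v] by (simp add: V_iff)
  qed
  have diag: "kernel a a = kernel \<one> \<one>" if a: "a \<in> carrier G" for a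
  proof -
    have "kernel (a \<otimes> \<one>) (a \<otimes> \<one>) = kernel \<one> \<one>"
    proof (rule kernel_invariant[OF bij_betw_left_mult[OF a]])
      fix v assume v: "v \<in> V"
      have "\<forall>x\<in>carrier G. v (inv a \<otimes> (a \<otimes> x)) = v x" using a by (simp add: inv_mult_cancel)
      thus "\<exists>w\<in>V. \<forall>x\<in>carrier G. w (a \<otimes> x) = v x"
        using shift[OF v inv_closed[OF a]] by (intro bexI[where x="\<lambda>y. v (inv a \<otimes> y)"])
    qed (use a shift in auto)
    thus ?thesis using a by simp
  qed
  define c where "c = kernel \<one> \<one>"
  have "c = 0"
  proof (rule ccontr)
    assume "c \<noteq> 0"
    hence c: "c > 0" using kernel_diag_nonneg[of \<one>] by (simp add: c_def)
    have "finite ((\<lambda>(s, t). inv s \<otimes> t) ` (S \<times> S))" using S by simp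
    \<comment> \<open>Two points \<open>g \<otimes> s\<close> and \<open>g \<otimes> t\<close> of
      one translate of \<open>S\<close> differ by the factor \<open>inv s \<otimes> t\<close>, so a
      translate that meets \<open>box n ts\<close> lies in the next box.\<close>
    then obtain ts where ts: "set ts = (\<lambda>(s, t). inv s \<otimes> t) ` (S \<times> S)"
      using finite_list by blast
    have tsc: "set ts \<subseteq> carrier G" using S unfolding ts by auto
    obtain n where n: "real (card (box (Suc n) ts)) - real (card (box n ts)) < c * real (card (box (Suc n) ts))"
      using ex_box_small_boundary[OF c] by blast
    let ?F = "box (Suc n) ts"
    let ?B = "?F - box n ts"
    have Fc: "?F \<subseteq> carrier G" using box_closed[OF tsc] .
    have "(\<Sum>x\<in>?F. kernel x x) \<le> real (card ?B)"
    proof (rule sum_kernel_diag_le_card[OF finite_box Fc])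
      fix v assume v: "v \<in> V" and zero: "\<forall>b\<in>?B. v b = 0"
      show "\<forall>x\<in>?F. v x = 0"
      proof (rule ccontr)
        assume "\<not> ?thesis"
        \<comment> \<open>\<open>W\<close> is the support of \<open>v\<close> cut off outside
          \<open>?F\<close>, and it lies in \<open>box n ts\<close>. A translate of \<open>S\<close>
          meeting \<open>W\<close> in one point stays inside \<open>?F\<close>, so its vanishing sum
          is a single nonzero value.\<close>
        define W where "W = {x \<in> ?F. v x \<noteq> 0}"
        have "finite W" "W \<noteq> {}" "W \<subseteq> carrier G"
          using \<open>\<not> (\<forall>x\<in>?F. v x = 0)\<close> finite_box[of "Suc n" ts] Fc by (auto simp: W_def)
        then obtain g s where gs: "g \<in> carrier G" "s \<in> S" "g \<otimes> s \<in> W"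
          and uniq: "\<forall>t\<in>S. g \<otimes> t \<in> W \<longrightarrow> t = s"
          using ex_unique_translate_point[OF tf S] by blast
        have inner: "g \<otimes> s \<in> box n ts" using gs(3) zero unfolding W_def by blast
        have "v (g \<otimes> t) = 0" if t: "t \<in> S" "t \<noteq> s" for t
        proof -
          have cl: "s \<in> carrier G" "t \<in> carrier G" using gs t S by auto
          have "inv s \<otimes> t \<in> set ts" using gs t unfolding ts by auto
          hence "(inv s \<otimes> t) \<otimes> (g \<otimes> s) \<in> ?F" using mult_in_box_Suc[OF tsc _ inner] by simp
          also have "(inv s \<otimes> t) \<otimes> (g \<otimes> s) = inv s \<otimes> (t \<otimes> (g \<otimes> s))"
            using cl gs(1) by (simp add: m_assoc)
          also have "t \<otimes> (g \<otimes> s) = s \<otimes> (g \<otimes> t)"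
            using cl gs(1) by (simp add: m_ac)
          also have "inv s \<otimes> (s \<otimes> (g \<otimes> t)) = g \<otimes> t" using cl gs(1) by (simp add: inv_mult_cancel)
          finally show ?thesis using uniq t unfolding W_def by blast
        qed
        hence "(\<Sum>t\<in>S. v (g \<otimes> t)) = (\<Sum>t\<in>S. if t = s then v (g \<otimes> s) else 0)"
          by (intro sum.cong) auto
        also have "\<dots> = v (g \<otimes> s)" using S gs by simp
        finally show False using v gs by (simp add: V_iff W_def)
      qed
    qed auto
    moreover have "(\<Sum>x\<in>?F. kernel x x) = (\<Sum>x\<in>?F. c)"
      unfolding c_def using diag Fc by (intro sum.cong refl) blast
    moreover have "real (card ?B) = real (card ?F) - real (card (box n ts))"
      using box_mono[of n "Suc n" ts] finite_box
      by (simp add: card_Diff_subset of_nat_diff card_mono)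
    ultimately show False using n by (simp add: mult.commute)
  qed
  moreover have "f \<in> V" using f by (simp add: V_iff)
  ultimately show ?thesis
    using vanish_if_kernel_diag_zero[OF x] diag[OF x] by (simp add: c_def)
qed

section \<open>The Pompeiu property\<close>

context group
begin

lemma sum_double_translate:
  assumes "g \<in> carrier G" "h \<in> carrier G" "K \<subseteq> carrier G"
  shows "sum f (double_translate G g K h) = (\<Sum>k\<in>K. f (g \<otimes> k \<otimes> h))"
proof -
  have "double_translate G g K h = (\<lambda>k. g \<otimes> k \<otimes> h) ` K" by (auto simp: double_translate_def)
  moreover have "inj_on (\<lambda>k. g \<otimes> k \<otimes> h) K" using assms by (auto simp: inj_on_def subset_iff)
  ultimately show ?thesis by (simp add: sum.reindex)
qed

lemma real_l2_pompeiu: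
  assumes no_finite_normal: "\<And>N. normal N G \<Longrightarrow> finite N \<Longrightarrow> N = {\<one>}"
    and K: "finite K" "K \<noteq> {}" "K \<subseteq> carrier G"
    and f: "f \<in> real_l2 (carrier G)"
      "\<And>g h. g \<in> carrier G \<Longrightarrow> h \<in> carrier G \<Longrightarrow> sum f (double_translate G g K h) = 0"
    and x: "x \<in> carrier G"
  shows "f x = 0"
proof -
  define V where "V = {f \<in> real_l2 (carrier G).
    \<forall>A\<in>(\<lambda>(g, h). double_translate G g K h) ` (carrier G \<times> carrier G). sum f A = 0}"
  interpret l2_subspace "carrier G" V
    unfolding V_def
    by (rule finite_sum_conditions_l2_subspace) (use K in \<open>auto simp: double_translate_def subset_iff\<close>)
  have V_iff: "v \<in> V \<longleftrightarrow> v \<in> real_l2 (carrier G) \<and>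
      (\<forall>g\<in>carrier G. \<forall>h\<in>carrier G. (\<Sum>k\<in>K. v (g \<otimes> k \<otimes> h)) = 0)" for v
    unfolding V_def using K by (simp add: sum_double_translate)
  have shift: "(\<lambda>y. v (a \<otimes> y \<otimes> b)) \<in> V" if v: "v \<in> V" and ab: "a \<in> carrier G" "b \<in> carrier G" for v a b
  proof -
    have "(\<Sum>k\<in>K. v (a \<otimes> (g \<otimes> k \<otimes> h) \<otimes> b)) = (\<Sum>k\<in>K. v ((a \<otimes> g) \<otimes> k \<otimes> (h \<otimes> b)))"
      if "g \<in> carrier G" "h \<in> carrier G" for g h
      using that ab K by (intro sum.cong) (auto simp: m_assoc subset_iff)
    moreover have "bij_betw (\<lambda>y. a \<otimes> y \<otimes> b) (carrier G) (carrier G)"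
      using ab by (intro bij_betw_byWitness[where f'="\<lambda>x. inv a \<otimes> x \<otimes> inv b"]) (auto simp: group_normalize)
    ultimately show ?thesis
      using v ab real_l2_reindex[of "\<lambda>y. a \<otimes> y \<otimes> b" "carrier G" v] by (simp add: V_iff)
  qed
  have invariant: "kernel (a \<otimes> y \<otimes> b) (a \<otimes> z \<otimes> b) = kernel y z"
    if ab: "a \<in> carrier G" "b \<in> carrier G" and yz: "y \<in> carrier G" "z \<in> carrier G" for a b y z
  proof (rule kernel_invariant[where \<sigma>="\<lambda>y. a \<otimes> y \<otimes> b", OF _ shift _ yz])
    show "bij_betw (\<lambda>y. a \<otimes> y \<otimes> b) (carrier G) (carrier G)"
      using ab by (intro bij_betw_byWitness[where f'="\<lambda>x. inv a \<otimes> x \<otimes> inv b"]) (auto simp: group_normalize)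
    fix v assume v: "v \<in> V"
    have "\<forall>x\<in>carrier G. v (inv a \<otimes> (a \<otimes> x \<otimes> b) \<otimes> inv b) = v x" using ab by (simp add: group_normalize)
    thus "\<exists>w\<in>V. \<forall>x\<in>carrier G. w (a \<otimes> x \<otimes> b) = v x"
      using shift[OF v, of "inv a" "inv b"] ab
      by (intro bexI[where x="\<lambda>y. v (inv a \<otimes> y \<otimes> inv b)"]) auto
  qed (use ab in auto)
  \<comment> \<open>\<open>p \<one>\<close> is the constant value of the diagonal of the kernel, so
    it remains to show that it is zero.\<close>
  define p where "p = kernel \<one>"
  have pV: "p \<in> V" unfolding p_def by (rule kernel_in) simp
  have p_outside: "p y = 0" if y: "y \<in> carrier G" "y \<notin> fc_center" for y
  \<comment> \<open>Conjugation fixes \<open>\<one>\<close>, so two-sided invariance makes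
    \<open>p\<close> constant on conjugacy classes.\<close>
  proof (rule constant_on_infinite_zero[OF in_l2[OF pV], of "conj_class y"])
    show "infinite (conj_class y)" "conj_class y \<subseteq> carrier G"
      using y conj_class_closed by (auto simp: fc_center_def)
    fix z assume "z \<in> conj_class y"
    then obtain g where g: "g \<in> carrier G" "z = inv g \<otimes> y \<otimes> g" by (auto simp: conj_class_def)
    show "p z = p y" using invariant[of "inv g" g \<one> y] g y by (simp add: p_def)
  qed
  let ?D = "G\<lparr>carrier := fc_center\<rparr>"
  have tf: "y = \<one>" if y: "y \<in> fc_center" "n > 0" "y [^] (n::nat) = \<one>" for y n
    using torsion_fc_in_finite_normal[OF y] no_finite_normal by blast
  interpret D: group ?D using subgroup.subgroup_is_group[OF fc_center_subgroup is_group] .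
  interpret D: comm_group ?D
    by (rule D.group_comm_groupI) (use fc_center_commute[OF tf] in auto)
  have D_tf: "D.torsion_free"
    unfolding D.torsion_free_def using tf by (auto simp: nat_pow_consistent[symmetric])
  obtain k where k: "k \<in> K" using K(2) by blast
  have kc: "k \<in> carrier G" using k K by auto
  \<comment> \<open>Dividing by \<open>k\<close> puts \<open>\<one>\<close> into the translate of
    \<open>K\<close>, so that its part in \<open>fc_center\<close> is nonempty.\<close>
  define S where "S = (\<lambda>l. inv k \<otimes> l) ` K \<inter> fc_center"
  have "inv k \<otimes> k \<in> S"
    unfolding S_def using k kc subgroup.one_closed[OF fc_center_subgroup] by (intro IntI imageI) auto
  hence S: "finite S" "S \<noteq> {}" "S \<subseteq> carrier ?D" using K by (auto simp: S_def)
  have fc_sub: "fc_center \<subseteq> carrier G" by (auto simp: fc_center_def)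
  have "p \<one> = 0"
  proof (rule D.torsion_free_l2_no_zero_divisors[OF D_tf S])
    show "p \<in> real_l2 (carrier ?D)"
      using in_l2[OF pV] summable_on_subset_banach[OF _ fc_sub] by (auto simp: real_l2_def)
    show "\<one> \<in> carrier ?D" using subgroup.one_closed[OF fc_center_subgroup] by simp
    fix g assume "g \<in> carrier ?D"
    hence g: "g \<in> fc_center" "g \<in> carrier G" using fc_sub by auto
    have "(\<Sum>s\<in>S. p (g \<otimes> s)) = (\<Sum>s\<in>(\<lambda>l. inv k \<otimes> l) ` K. p (g \<otimes> s))"
    proof (rule sum.mono_neutral_left)
      \<comment> \<open>Multiplication by \<open>g \<in> fc_center\<close> preserves the complement
        of \<open>fc_center\<close>, where \<open>p\<close> vanishes; hence the sum over
        \<open>S\<close> equals one over a full translate of \<open>K\<close>.\<close>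
      show "\<forall>s\<in>(\<lambda>l. inv k \<otimes> l) ` K - S. p (g \<otimes> s) = 0"
      proof
        fix s assume s: "s \<in> (\<lambda>l. inv k \<otimes> l) ` K - S"
        have sc: "s \<in> carrier G" "s \<notin> fc_center" using s kc K by (auto simp: S_def)
        have "g \<otimes> s \<notin> fc_center"
        proof
          assume "g \<otimes> s \<in> fc_center"
          hence "inv g \<otimes> (g \<otimes> s) \<in> fc_center"
            by (rule subgroup.m_closed[OF fc_center_subgroup subgroup.m_inv_closed[OF fc_center_subgroup g(1)]])
          thus False using sc g by (simp add: inv_mult_cancel)
        qed
        thus "p (g \<otimes> s) = 0" using p_outside g sc by simp
      qed
    qed (use K in \<open>auto simp: S_def\<close>)
    also have "\<dots> = (\<Sum>l\<in>K. p (g \<otimes> (inv k \<otimes> l)))"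
      by (rule sum_left_translate) (use kc K in auto)
    also have "\<dots> = (\<Sum>l\<in>K. p ((g \<otimes> inv k) \<otimes> l \<otimes> \<one>))"
      using g kc K by (intro sum.cong) (auto simp: m_assoc subset_iff)
    also have "\<dots> = 0" using pV g kc by (simp add: V_iff)
    finally show "(\<Sum>s\<in>S. p (g \<otimes>\<^bsub>?D\<^esub> s)) = 0" by simp
  qed
  hence "kernel x x = 0" using invariant[of x \<one> \<one> \<one>] x by (simp add: p_def)
  moreover have "f \<in> V" using f K by (simp add: V_iff sum_double_translate)
  ultimately show ?thesis using vanish_if_kernel_diag_zero[OF x] by simp
qed

section \<open>Complex functions and the converse direction\<close>

text \<open>The sum conditions have real coefficients, so they pass to real and imaginary parts;
  \<open>r\<close> stands for either.\<close>

lemma l2_fun_pompeiu_group: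
  assumes "\<And>N. normal N G \<Longrightarrow> finite N \<Longrightarrow> N = {\<one>}"
  shows "pompeiu_group G (l2_fun G)"
  unfolding pompeiu_group_def pompeiu_set_def
proof (intro allI impI conjI ballI)
  fix K f x
  assume K: "finite K \<and> K \<subseteq> carrier G \<and> K \<noteq> {}" and f: "f \<in> l2_fun G"
    and zero: "\<forall>g\<in>carrier G. \<forall>h\<in>carrier G. sum f (double_translate G g K h) = 0" and x: "x \<in> carrier G"
  have sq: "(\<lambda>x. (norm (f x))\<^sup>2) summable_on carrier G" using f by (simp add: l2_fun_def)
  have part: "r (f x) = 0" if r: "\<And>z. \<bar>r z\<bar> \<le> norm z" "\<And>A. r (sum f A) = (\<Sum>a\<in>A. r (f a))" "r 0 = 0" for r :: "complex \<Rightarrow> real"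
  proof (rule real_l2_pompeiu[OF assms, where K=K and f="\<lambda>x. r (f x)"])
    show "(\<lambda>x. r (f x)) \<in> real_l2 (carrier G)"
      unfolding real_l2_def mem_Collect_eq
      by (rule summable_on_comparison_test[OF sq]) (use r(1) in \<open>auto simp: abs_le_square_iff[symmetric]\<close>)
    show "(\<Sum>y\<in>double_translate G g K h. r (f y)) = 0" if "g \<in> carrier G" "h \<in> carrier G" for g h
      using zero that r(2)[of "double_translate G g K h"] r(3) by simp
  qed (use K x in auto)
  show "f x = 0"
    using part[of Re] part[of Im] abs_Re_le_cmod abs_Im_le_cmod by (simp add: complex_eq_iff)
qed auto

lemma finite_normal_not_pompeiu:
  assumes N: "normal N G" "finite N" "N \<noteq> {\<one>}"
  shows "\<not> pompeiu_group G (l2_fun G)"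
proof
  assume pg: "pompeiu_group G (l2_fun G)"
  interpret N: normal N G by fact
  obtain n where n: "n \<in> N" "n \<noteq> \<one>" using N(3) N.one_closed by blast
  have nc: "n \<in> carrier G" using n N.subset by auto
  \<comment> \<open>The restriction makes the difference of point masses extensional, as membership
    in \<open>l2_fun G\<close> demands.\<close>
  define f :: "'a \<Rightarrow> complex" where
    "f = restrict (\<lambda>x. (if x = \<one> then 1 else 0) - (if x = n then 1 else 0)) (carrier G)"
  have "(\<lambda>x. (norm (f x))\<^sup>2) summable_on {\<one>, n}" by simp
  hence "(\<lambda>x. (norm (f x))\<^sup>2) summable_on carrier G"
    by (rule summable_on_cong_neutral[THEN iffD1, rotated -1]) (use nc in \<open>auto simp: f_def\<close>)
  hence f: "f \<in> l2_fun G" by (simp add: l2_fun_def f_def)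
  have zero: "sum f (double_translate G g N h) = 0" if g: "g \<in> carrier G" and h: "h \<in> carrier G" for g h
  proof -
    let ?A = "double_translate G g N h"
    have A: "?A \<subseteq> carrier G" using g h N.subset by (auto simp: double_translate_def subset_iff)
    have fin: "finite ?A" using N(2) by (simp add: double_translate_def)
    have mem: "y \<otimes> m \<in> ?A" if y: "y \<in> ?A" and m: "m \<in> N" for y m
    proof -
      obtain l where l: "l \<in> N" "y = g \<otimes> l \<otimes> h" using y by (auto simp: double_translate_def)
      have cl: "l \<in> carrier G" "m \<in> carrier G" using l m N.subset by auto
      have "h \<otimes> m \<otimes> inv h \<in> N" using N.inv_op_closed2 h m by simp
      hence "l \<otimes> (h \<otimes> m \<otimes> inv h) \<in> N" using l by simp
      moreover have "y \<otimes> m = g \<otimes> (l \<otimes> (h \<otimes> m \<otimes> inv h)) \<otimes> h"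
        using cl g h by (simp add: l group_normalize)
      ultimately show ?thesis by (auto simp: double_translate_def)
    qed
    \<comment> \<open>By normality \<open>?A\<close> is closed under right multiplication by
      \<open>N\<close>, so the two point masses are both counted or both missed.\<close>
    have "\<one> \<in> ?A \<longleftrightarrow> n \<in> ?A"
      using mem[of \<one> n] mem[of n "inv n"] n nc by auto
    moreover have "sum f ?A = (\<Sum>x\<in>?A. (if x = \<one> then 1 else 0) - (if x = n then 1 else 0))"
      using A by (intro sum.cong) (auto simp: f_def)
    ultimately show ?thesis using fin by (simp add: sum_subtractf)
  qed
  have "pompeiu_set G (l2_fun G) N"
    using pg[unfolded pompeiu_group_def, rule_format, of N] N(2) N.subset N.one_closed by blast
  hence "\<forall>x\<in>carrier G. f x = 0"
    using f zero by (simp add: pompeiu_set_def)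
  hence "f \<one> = 0" by simp
  thus False using n by (simp add: f_def)
qed

end

theorem theorem2:
  fixes G :: "('a, 'b) monoid_scheme"
  assumes "group G" and "finitely_generated_group G"
  shows "pompeiu_group G (l2_fun G) \<longleftrightarrow>
         \<not> (\<exists>N. normal N G \<and> finite N \<and> N \<noteq> {\<one>\<^bsub>G\<^esub>})"
  using group.l2_fun_pompeiu_group[OF assms(1)] group.finite_normal_not_pompeiu[OF assms(1)] by blast

end
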